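(* For a monoid variety $\mathbf V$, the following are equivalent: (i) $\mathbf V$ is a modular and lower-modular element of the lattice $\mathbb{MON}$; (ii) $\mathbf V$ is a standard element of the lattice $\mathbb{MON}$; (iii) $\mathbf V$ is a neutral element of the lattice $\mathbb{MON}$; (iv) $\mathbf V$ is one of the varieties $\mathbf T$, $\mathbf{SL}$ or $\mathbf{MON}$.
   Context: Monoids are considered as semigroups equipped with an additional $0$-ary operation that fixes the identity element; a monoid variety is a class of all monoids satisfying some set of identities in this signature (identities $\mathbf u\approx\mathbf v$ between words, i.e. elements of the free monoid over a countably infinite alphabet, the empty word allowed). $\mathbb{MON}$ denotes the lattice of all monoid varieties ordered by inclusion, with $\wedge$ the intersection and $\vee$ the join (the smallest variety containing both). $\mathbf T$ is the trivial variety of monoids, $\mathbf{SL}$ is the variety of all semilattice monoids (commutative idempotent monoids), and $\mathbf{MON}$ is the variety of all monoids. An element $x$ of a lattice $L$ is called: neutral if for all $y,z\in L$, $(x\vee y)\wedge(y\vee z)\wedge(z\vee x)=(x\wedge y)\vee(y\wedge z)\vee(z\wedge x)$; standard if for all $y,z\in L$, $(x\vee y)\wedge z=(x\wedge z)\vee(y\wedge z)$; modular if for all $y,z\in L$, $y\le z$ implies $(x\vee y)\wedge z=(x\wedge z)\vee y$; lower-modular if for all $y,z\in L$, $x\le y$ implies $x\vee(y\wedge z)=y\wedge(x\vee z)$. *)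

theory Defs
  imports "HOL-Algebra.Group" "HOL-Library.Countable_Set"
begin

(* HOL-Algebra has constants of the same names for its record-based lattices. *)
hide_const (open) Lattice.sup Lattice.inf

definition neutral_element :: "'l::lattice \<Rightarrow> bool" where
  "neutral_element x \<longleftrightarrow>
     (\<forall>y z. inf (inf (sup x y) (sup y z)) (sup z x) = sup (sup (inf x y) (inf y z)) (inf z x))"

definition standard_element :: "'l::lattice \<Rightarrow> bool" where
  "standard_element x \<longleftrightarrow> (\<forall>y z. inf (sup x y) z = sup (inf x z) (inf y z))"

definition modular_element :: "'l::lattice \<Rightarrow> bool" where
  "modular_element x \<longleftrightarrow> (\<forall>y z. y \<le> z \<longrightarrow> inf (sup x y) z = sup (inf x z) y)"

definition lower_modular_element :: "'l::lattice \<Rightarrow> bool" where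
  "lower_modular_element x \<longleftrightarrow> (\<forall>y z. x \<le> y \<longrightarrow> sup x (inf y z) = inf y (sup x z))"


type_synonym word = "nat list"

primrec eval_word :: "('a, 'm) monoid_scheme \<Rightarrow> (nat \<Rightarrow> 'a) \<Rightarrow> word \<Rightarrow> 'a" where
  "eval_word M \<phi> [] = \<one>\<^bsub>M\<^esub>"
| "eval_word M \<phi> (x # w) = \<phi> x \<otimes>\<^bsub>M\<^esub> eval_word M \<phi> w"

definition satisfies :: "('a, 'm) monoid_scheme \<Rightarrow> word \<Rightarrow> word \<Rightarrow> bool" where
  "satisfies M u v \<longleftrightarrow> (\<forall>\<phi>. range \<phi> \<subseteq> carrier M \<longrightarrow> eval_word M \<phi> u = eval_word M \<phi> v)"

definition models :: "(word \<times> word) set \<Rightarrow> 'a monoid set" where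
  "models \<Sigma> = {M. monoid M \<and> (\<forall>(u, v) \<in> \<Sigma>. satisfies M u v)}"


(* A class of all monoids cannot be a HOL set, so a variety consists of the monoids whose
   carrier is a set of elements of type 'a.  For every infinite type 'a this is no
   restriction: see models_subset_transfer below. *)

typedef 'a monoid_variety = "range models :: 'a monoid set set"
  morphisms members variety_of_members
  by blast

setup_lifting type_definition_monoid_variety

lemma models_Un: "models (\<Sigma> \<union> \<Gamma>) = models \<Sigma> \<inter> models \<Gamma>"
  by (auto simp: models_def)

lemma models_Union: "models (\<Union>\<S>) = {M. monoid M} \<inter> (\<Inter>\<Sigma>\<in>\<S>. models \<Sigma>)"
  by (auto simp: models_def)

lemma models_empty: "models {} = {M. monoid M}"
  by (simp add: models_def)

lemma Inter_varieties_in_range_models: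
  fixes \<V> :: "'a monoid set set"
  assumes "\<V> \<subseteq> range models" and "\<V> \<noteq> {}"
  shows "\<Inter>\<V> \<in> range models"
proof -
  have 1: "\<Inter>\<V> = models (\<Union>{\<Sigma>. models \<Sigma> \<in> \<V>})"
  proof (intro equalityI subsetI)
    fix M :: "'a monoid" assume M: "M \<in> \<Inter>\<V>"
    obtain \<Sigma>\<^sub>0 where "models \<Sigma>\<^sub>0 \<in> \<V>" using assms by auto
    with M have "M \<in> models \<Sigma>\<^sub>0" by blast
    then have "monoid M" by (simp add: models_def)
    with M show "M \<in> models (\<Union>{\<Sigma>. models \<Sigma> \<in> \<V>})" by (auto simp: models_Union)
  next
    fix M :: "'a monoid" assume M: "M \<in> models (\<Union>{\<Sigma>. models \<Sigma> \<in> \<V>})"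
    show "M \<in> \<Inter>\<V>"
    proof
      fix W assume "W \<in> \<V>"
      moreover from this assms(1) obtain \<Sigma> where "W = models \<Sigma>" by blast
      ultimately show "M \<in> W" using M by (auto simp: models_Union)
    qed
  qed
  show ?thesis unfolding 1 by simp
qed

instantiation monoid_variety :: (type) lattice
begin

lift_definition less_eq_monoid_variety :: "'a monoid_variety \<Rightarrow> 'a monoid_variety \<Rightarrow> bool"
  is "(\<subseteq>)" .

lift_definition less_monoid_variety :: "'a monoid_variety \<Rightarrow> 'a monoid_variety \<Rightarrow> bool"
  is "(\<subset>)" .

lift_definition inf_monoid_variety ::
  "'a monoid_variety \<Rightarrow> 'a monoid_variety \<Rightarrow> 'a monoid_variety"
  is "(\<inter>)" by (auto simp flip: models_Un)

lift_definition sup_monoid_variety ::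
  "'a monoid_variety \<Rightarrow> 'a monoid_variety \<Rightarrow> 'a monoid_variety"
  is "\<lambda>V W. \<Inter>{U \<in> range models. V \<subseteq> U \<and> W \<subseteq> U}"
proof -
  fix V W :: "'a monoid set"
  assume "V \<in> range models" "W \<in> range models"
  then have "models {} \<in> {U \<in> range models. V \<subseteq> U \<and> W \<subseteq> U}"
    by (auto simp: models_def)
  then show "\<Inter>{U \<in> range models. V \<subseteq> U \<and> W \<subseteq> U} \<in> range models"
    by (intro Inter_varieties_in_range_models) blast+
qed

instance
  by (standard; transfer) auto

end

lift_definition trivial_variety :: "'a monoid_variety"
  is "{M. monoid M \<and> carrier M = {\<one>\<^bsub>M\<^esub>}}"
proof -
  have "{M. monoid M \<and> carrier M = {\<one>\<^bsub>M\<^esub>}} = (models {([0], [])} :: 'a monoid set)"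
  proof (intro equalityI subsetI)
    fix M :: "'a monoid" assume M: "M \<in> models {([0], [])}"
    then interpret monoid M by (simp add: models_def)
    have "x = \<one>\<^bsub>M\<^esub>" if "x \<in> carrier M" for x
    proof -
      have "range (\<lambda>_. x) \<subseteq> carrier M" using that by auto
      then have "eval_word M (\<lambda>_. x) [0] = eval_word M (\<lambda>_. x) []"
        using M unfolding models_def satisfies_def by blast
      with that show ?thesis by simp
    qed
    then have "carrier M = {\<one>\<^bsub>M\<^esub>}" using one_closed by blast
    then show "M \<in> {M. monoid M \<and> carrier M = {\<one>\<^bsub>M\<^esub>}}"
      using monoid_axioms by simp
  next
    fix M :: "'a monoid" assume "M \<in> {M. monoid M \<and> carrier M = {\<one>\<^bsub>M\<^esub>}}"
    then have "monoid M" and c: "carrier M = {\<one>\<^bsub>M\<^esub>}" by auto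
    then interpret monoid M by simp
    have "eval_word M \<phi> [0] = eval_word M \<phi> []"
      if "range \<phi> \<subseteq> carrier M" for \<phi> :: "nat \<Rightarrow> 'a"
    proof -
      have "\<phi> 0 = \<one>\<^bsub>M\<^esub>" using that unfolding c by auto
      then show ?thesis by simp
    qed
    then show "M \<in> models {([0], [])}"
      using monoid_axioms unfolding models_def satisfies_def by blast
  qed
  then show "{M. monoid M \<and> carrier M = {\<one>\<^bsub>M\<^esub>}} \<in> (range models :: 'a monoid set set)"
    by simp
qed

lift_definition semilattice_variety :: "'a monoid_variety"
  is "{M. comm_monoid M \<and> (\<forall>x \<in> carrier M. x \<otimes>\<^bsub>M\<^esub> x = x)}"
proof -
  have "{M. comm_monoid M \<and> (\<forall>x \<in> carrier M. x \<otimes>\<^bsub>M\<^esub> x = x)}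
      = (models {([0, 0], [0]), ([0, 1], [1, 0])} :: 'a monoid set)"
  proof (intro equalityI subsetI)
    fix M :: "'a monoid" assume M: "M \<in> models {([0, 0], [0]), ([0, 1], [1, 0])}"
    then interpret monoid M by (simp add: models_def)
    have idem: "x \<otimes>\<^bsub>M\<^esub> x = x" if "x \<in> carrier M" for x
    proof -
      have "range (\<lambda>_. x) \<subseteq> carrier M" using that by auto
      then have "eval_word M (\<lambda>_. x) [0, 0] = eval_word M (\<lambda>_. x) [0]"
        using M unfolding models_def satisfies_def by blast
      with that show ?thesis by simp
    qed
    have comm: "x \<otimes>\<^bsub>M\<^esub> y = y \<otimes>\<^bsub>M\<^esub> x" if "x \<in> carrier M" "y \<in> carrier M" for x y
    proof -
      let ?\<phi> = "\<lambda>n::nat. if n = 0 then x else y"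
      have "range ?\<phi> \<subseteq> carrier M" using that by auto
      then have "eval_word M ?\<phi> [0, 1] = eval_word M ?\<phi> [1, 0]"
        using M unfolding models_def satisfies_def by blast
      with that show ?thesis by simp
    qed
    have "comm_monoid M" by (rule monoid_comm_monoidI) (rule comm)
    with idem show "M \<in> {M. comm_monoid M \<and> (\<forall>x \<in> carrier M. x \<otimes>\<^bsub>M\<^esub> x = x)}"
      by simp
  next
    fix M :: "'a monoid"
    assume "M \<in> {M. comm_monoid M \<and> (\<forall>x \<in> carrier M. x \<otimes>\<^bsub>M\<^esub> x = x)}"
    then have cm: "comm_monoid M" and idem: "\<And>x. x \<in> carrier M \<Longrightarrow> x \<otimes>\<^bsub>M\<^esub> x = x" by auto
    interpret comm_monoid M by (rule cm)
    show "M \<in> models {([0, 0], [0]), ([0, 1], [1, 0])}"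
      using monoid_axioms by (auto simp: models_def satisfies_def idem m_comm range_subsetD)
  qed
  then show "{M. comm_monoid M \<and> (\<forall>x \<in> carrier M. x \<otimes>\<^bsub>M\<^esub> x = x)}
      \<in> (range models :: 'a monoid set set)"
    by simp
qed

lift_definition all_monoids_variety :: "'a monoid_variety"
  is "{M. monoid M}"
  by (metis models_empty rangeI)


lemma eval_word_closed:
  assumes "monoid M" and "range \<phi> \<subseteq> carrier M"
  shows "eval_word M \<phi> w \<in> carrier M"
proof -
  interpret monoid M by fact
  show ?thesis using assms(2) by (induction w) (auto simp: range_subsetD)
qed

lemma eval_word_append:
  assumes "monoid M" and "range \<phi> \<subseteq> carrier M"
  shows "eval_word M \<phi> (v @ w) = eval_word M \<phi> v \<otimes>\<^bsub>M\<^esub> eval_word M \<phi> w"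
proof -
  interpret monoid M by fact
  show ?thesis using assms
    by (induction v) (auto simp: range_subsetD eval_word_closed m_assoc)
qed

(* Inclusion of varieties in an infinite universe implies inclusion in every universe, since an
   identity only involves the countable submonoid generated by the values of its letters. *)
theorem models_subset_transfer:
  assumes inf: "infinite (UNIV :: 'a set)"
    and sub: "(models \<Sigma> :: 'a monoid set) \<subseteq> models \<Gamma>"
  shows "(models \<Sigma> :: 'b monoid set) \<subseteq> models \<Gamma>"
proof
  fix M :: "'b monoid" assume M: "M \<in> models \<Sigma>"
  then interpret monoid M by (simp add: models_def)
  have mon: "monoid M" by (rule monoid_axioms)
  have "satisfies M u v" if uv: "(u, v) \<in> \<Gamma>" for u v
    unfolding satisfies_def
  proof (intro allI impI)
    fix \<phi> :: "nat \<Rightarrow> 'b" assume \<phi>: "range \<phi> \<subseteq> carrier M"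
    define C where "C = range (eval_word M \<phi>)"
    have Csub: "C \<subseteq> carrier M" using eval_word_closed[OF mon \<phi>] by (auto simp: C_def)
    have Cone: "\<one>\<^bsub>M\<^esub> \<in> C" unfolding C_def by (rule range_eqI[of _ _ "[]"]) simp
    have Cmult: "x \<otimes>\<^bsub>M\<^esub> y \<in> C" if xy: "x \<in> C" "y \<in> C" for x y
    proof -
      from xy obtain v w where "x = eval_word M \<phi> v" "y = eval_word M \<phi> w" by (auto simp: C_def)
      then show ?thesis unfolding C_def
        by (intro range_eqI[of _ _ "v @ w"]) (simp add: eval_word_append[OF mon \<phi>])
    qed
    have Cgen: "\<phi> n \<in> C" for n
      unfolding C_def using \<phi> by (intro range_eqI[of _ _ "[n]"]) (simp add: range_subsetD)
    have "countable C" by (simp add: C_def)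
    then have inj1: "inj_on (to_nat_on C) C" by (rule inj_on_to_nat_on)
    obtain g :: "nat \<Rightarrow> 'a" where g: "inj g" using infinite_countable_subset[OF inf] by blast
    define f where "f = g \<circ> to_nat_on C"
    have f: "inj_on f C" unfolding f_def
      using inj1 g by (auto intro: comp_inj_on inj_on_subset)
    define h where "h = inv_into C f"
    have hf: "h (f x) = x" if "x \<in> C" for x using f that by (simp add: h_def)
    define N :: "'a monoid" where
      "N = \<lparr>carrier = f ` C, mult = \<lambda>x y. f (h x \<otimes>\<^bsub>M\<^esub> h y), one = f \<one>\<^bsub>M\<^esub>\<rparr>"
    have N: "carrier N = f ` C" "\<And>x y. x \<otimes>\<^bsub>N\<^esub> y = f (h x \<otimes>\<^bsub>M\<^esub> h y)" "\<one>\<^bsub>N\<^esub> = f \<one>\<^bsub>M\<^esub>"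
      by (simp_all add: N_def)
    have monN: "monoid N"
      by (rule monoidI) (use Csub in \<open>auto simp: N hf Cone Cmult m_assoc subsetD\<close>)
    have eval_in_C: "eval_word M \<theta> w \<in> C" if "range \<theta> \<subseteq> C" for \<theta> :: "nat \<Rightarrow> 'b" and w
      using that by (induction w) (auto simp: Cone Cmult range_subsetD)
    have ev: "eval_word N (f \<circ> \<theta>) w = f (eval_word M \<theta> w)" if "range \<theta> \<subseteq> C" for \<theta> :: "nat \<Rightarrow> 'b" and w
      using that by (induction w) (auto simp: N hf eval_in_C range_subsetD)
    have "satisfies N s t" if st: "(s, t) \<in> \<Sigma>" for s t
      unfolding satisfies_def
    proof (intro allI impI)
      fix \<psi> :: "nat \<Rightarrow> 'a" assume \<psi>: "range \<psi> \<subseteq> carrier N"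
      then have \<psi>h: "\<psi> = f \<circ> (h \<circ> \<psi>)" and hC: "range (h \<circ> \<psi>) \<subseteq> C"
        by (auto simp: N fun_eq_iff h_def f_inv_into_f inv_into_into range_subsetD)
      have "range (h \<circ> \<psi>) \<subseteq> carrier M" using hC Csub by blast
      then have "eval_word M (h \<circ> \<psi>) s = eval_word M (h \<circ> \<psi>) t"
        using M st unfolding models_def satisfies_def by blast
      then show "eval_word N \<psi> s = eval_word N \<psi> t"
        using ev[OF hC] \<psi>h by metis
    qed
    with monN have "N \<in> models \<Sigma>" by (auto simp: models_def)
    with sub uv have sat: "satisfies N u v" by (auto simp: models_def)
    have \<phi>C: "range \<phi> \<subseteq> C" using Cgen by auto
    then have "range (f \<circ> \<phi>) \<subseteq> carrier N" by (auto simp: N)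
    with sat have "f (eval_word M \<phi> u) = f (eval_word M \<phi> v)"
      unfolding satisfies_def by (metis ev[OF \<phi>C])
    with f show "eval_word M \<phi> u = eval_word M \<phi> v"
      using eval_in_C[OF \<phi>C] by (auto dest: inj_onD)
  qed
  with mon show "M \<in> models \<Gamma>" by (auto simp: models_def)
qed

end

theory Submission
  imports Defs "HOL-Library.Multiset" "HOL-Library.Sublist" "HOL-Combinatorics.Permutations"
begin

text \<open>
  A monoid variety is determined by its identities, and the sets of identities are exactly the fully invariant
  congruences of the free monoid. Inclusion is reversed: the join of two varieties corresponds to the
  intersection of the congruences, the meet to the transitive closure of their union. Everything is therefore a
  question about chains of words. Write \<open>\<theta>\<close> for the identities of \<open>V\<close>.

  In every lattice a neutral element is standard, and a standard element is modular and lower-modular. The least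
  and the greatest element are neutral, so two things remain.

  \<^emph>\<open>The variety of semilattices is neutral.\<close> Its identities are the pairs of words with the
  same letters. A variety with an identity that changes the set of letters satisfies \<open>x^n = 1\<close> for
  some \<open>n > 0\<close>, and only such varieties need attention. In a chain of words from \<open>u\<close>
  to \<open>v\<close>, where \<open>u\<close> and \<open>v\<close> have the same letters, one can then delete
  all foreign letters and multiply every word by the \<open>n\<close>-th powers of the letters of
  \<open>u\<close>; after that all steps preserve the letters (\<open>median_same_content\<close>).

  \<^emph>\<open>A modular and lower-modular variety is one of the three.\<close> Let \<open>\<theta>\<close> be
  nontrivial, and let \<open>raise n\<close> replace every letter by its \<open>n\<close>-th power. For any
  words \<open>a\<close> and \<open>b\<close>, one can go from \<open>a\<close> to \<open>b\<close> through
  \<open>raise n a\<close> and \<open>raise n b\<close>: the outer steps belong to any congruence with \<open>x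
  = x^n\<close>, the middle step to the congruence that the raised identity generates. The raised identity is so
  coarse that it cannot act on words without high powers. The two conditions on \<open>V\<close> say that the
  chain can be replaced by another one, which then has to be trivial.

  For lower-modularity, the outer steps are taken from the identities of a finite symmetric group that separates
  \<open>a\<close> from \<open>b\<close> (\<open>lower_modular_no_bounded_class\<close>). This excludes
  nontrivial identities \<open>(a, b)\<close> in which \<open>a\<close> and \<open>b\<close> are rearrangements
  of each other and the words equal to \<open>a\<close> in \<open>V\<close> have bounded numbers of occurrences
  of all letters but one. If \<open>\<theta>\<close> preserves the number of occurrences of all letters, every
  identity is of this kind. Otherwise \<open>x^k = x^j\<close> with \<open>k < j\<close> holds, hence \<open>x^j
  t x^k = x^k t x^j\<close>, and this identity is of this kind unless \<open>x = x^n\<close> holds for some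
  \<open>n > 1\<close>. So \<open>V\<close> satisfies \<open>x = x^n\<close> with \<open>n > 1\<close>.

  For modularity, the outer steps are taken from \<open>\<theta>\<close> itself, using \<open>x = x^n\<close>.
  They show that \<open>V\<close> satisfies every identity \<open>(a, b)\<close> between words with the same
  letters for which \<open>a\<close> is square-free and repeated application of the identity to \<open>a\<close>
  leads only to \<open>a\<close> and \<open>b\<close> (\<open>modular_completely_regular_satisfies\<close>). The
  identity \<open>x y = y x\<close> is of this kind, and so is an explicit identity of length \<open>7\<close>
  that reduces to \<open>x^3 = x^2\<close> when all letters but one are deleted. Together with \<open>x =
  x^n\<close> these two give all identities of semilattices.
\<close>

section \<open>Elements of special type in an arbitrary lattice\<close>

lemma neutral_imp_modular:
  fixes x :: "'a::lattice"
  assumes "neutral_element x"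
  shows "modular_element x"
  unfolding modular_element_def
proof (intro allI impI)
  fix y z :: 'a assume "y \<le> z"
  have "inf (inf (sup x y) (sup y z)) (sup z x) = sup (sup (inf x y) (inf y z)) (inf z x)"
    using assms unfolding neutral_element_def by blast
  moreover have "inf (inf (sup x y) (sup y z)) (sup z x) = inf (sup x y) z"
    using \<open>y \<le> z\<close> by (simp add: sup.absorb2 inf.assoc)
  moreover have "sup (sup (inf x y) (inf y z)) (inf z x) = sup (inf x z) y"
    using \<open>y \<le> z\<close> by (metis inf.absorb1 inf.commute inf_le2 sup.absorb2 sup.commute)
  ultimately show "inf (sup x y) z = sup (inf x z) y" by simp
qed

lemma neutral_imp_lower_modular:
  fixes x :: "'a::lattice"
  assumes "neutral_element x"
  shows "lower_modular_element x"
  unfolding lower_modular_element_def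
proof (intro allI impI)
  fix y z :: 'a assume "x \<le> y"
  have "inf (inf (sup x y) (sup y z)) (sup z x) = sup (sup (inf x y) (inf y z)) (inf z x)"
    using assms unfolding neutral_element_def by blast
  moreover have "inf (inf (sup x y) (sup y z)) (sup z x) = inf y (sup x z)"
    using \<open>x \<le> y\<close> by (simp add: sup.absorb2 sup.commute)
  moreover have "sup (sup (inf x y) (inf y z)) (inf z x) = sup x (inf y z)"
    using \<open>x \<le> y\<close> by (metis inf.absorb1 inf.commute sup.assoc sup.commute sup_inf_absorb)
  ultimately show "sup x (inf y z) = inf y (sup x z)" by simp
qed

lemma modular_distributive_imp_standard:
  fixes x :: "'a::lattice"
  assumes "modular_element x" and "\<And>y z. sup x (inf y z) = inf (sup x y) (sup x z)"
  shows "standard_element x"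
  unfolding standard_element_def
proof (intro allI)
  fix y z :: 'a
  have "sup (inf x z) (inf y z) = inf (sup x (inf y z)) z"
    using assms(1) unfolding modular_element_def by simp
  also have "\<dots> = inf (sup x y) z"
    unfolding assms(2) by (metis inf.absorb2 inf.assoc sup_ge2)
  finally show "inf (sup x y) z = sup (inf x z) (inf y z)" ..
qed

text \<open>Neutrality self-improves: joining \<open>x\<close> to both forms of the median of \<open>x\<close>, \<open>y\<close>, \<open>z\<close> gives, by
  lower-modularity on one side and absorption on the other, that \<open>x\<close> distributes over meets.\<close>
lemma neutral_imp_standard:
  fixes x :: "'a::lattice"
  assumes n: "neutral_element x"
  shows "standard_element x"
proof (rule modular_distributive_imp_standard)
  show "modular_element x" using n by (rule neutral_imp_modular)
  fix y z :: 'a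
  let ?A = "inf (sup x y) (sup x z)"
  have "sup x (inf ?A (sup y z)) = inf ?A (sup x (sup y z))"
    using neutral_imp_lower_modular[OF n] unfolding lower_modular_element_def by simp
  also have "\<dots> = ?A" by (meson inf.absorb1 inf_le1 order_trans sup.mono sup_ge1 order_refl)
  finally have "?A = sup x (inf ?A (sup y z))" ..
  also have "inf ?A (sup y z) = inf (inf (sup x y) (sup y z)) (sup z x)"
    by (simp add: inf.assoc inf.commute inf.left_commute sup.commute)
  also have "\<dots> = sup (sup (inf x y) (inf y z)) (inf z x)"
    using n unfolding neutral_element_def by blast
  also have "sup x \<dots> = sup x (inf y z)"
    by (metis inf.commute sup.assoc sup.commute sup_inf_absorb)
  finally show "sup x (inf y z) = ?A" ..
qed

lemma standard_imp_modular: "standard_element x \<Longrightarrow> modular_element x"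
  unfolding standard_element_def modular_element_def by (simp add: inf.absorb1)

lemma standard_imp_lower_modular:
  fixes x :: "'a::lattice"
  assumes "standard_element x"
  shows "lower_modular_element x"
  unfolding lower_modular_element_def
proof (intro allI impI)
  fix y z :: 'a assume "x \<le> y"
  have "inf (sup x z) y = sup (inf x y) (inf z y)"
    using assms unfolding standard_element_def by blast
  then show "sup x (inf y z) = inf y (sup x z)"
    using \<open>x \<le> y\<close> by (simp add: inf.absorb1 inf.commute)
qed

lemma bottom_neutral:
  assumes bot: "\<And>y. x \<le> y"
  shows "neutral_element x"
proof -
  have "sup x y = y" "sup y x = y" "inf x y = x" "inf y x = x" for y
    using bot[of y] by (simp_all only: sup.absorb1 sup.absorb2 inf.absorb1 inf.absorb2)
  then show ?thesis by (simp add: neutral_element_def inf.absorb1 inf.absorb2 le_infI1 le_supI1 inf.commute)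
qed

lemma top_neutral:
  assumes top: "\<And>y. y \<le> x"
  shows "neutral_element x"
proof -
  have "sup x y = x" "sup y x = x" "inf x y = y" "inf y x = y" for y
    using top[of y] by (simp_all only: sup.absorb1 sup.absorb2 inf.absorb1 inf.absorb2)
  then show ?thesis by (simp add: neutral_element_def sup.absorb1 sup.absorb2 le_infI1 le_supI1 sup.commute sup.left_commute)
qed

section \<open>Fully invariant congruences on the free monoid\<close>

primrec subst :: "(nat \<Rightarrow> word) \<Rightarrow> word \<Rightarrow> word" where
  "subst \<phi> [] = []"
| "subst \<phi> (x # w) = \<phi> x @ subst \<phi> w"

lemma subst_append [simp]: "subst \<phi> (u @ v) = subst \<phi> u @ subst \<phi> v"
  by (induction u) auto

lemma subst_subst: "subst \<psi> (subst \<phi> w) = subst (\<lambda>x. subst \<psi> (\<phi> x)) w"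
  by (induction w) auto

lemma subst_letters [simp]: "subst (\<lambda>x. [f x]) w = map f w"
  by (induction w) auto

lemma subst_eq_Nil: "subst \<phi> w = [] \<longleftrightarrow> (\<forall>x\<in>set w. \<phi> x = [])"
  by (induction w) auto

lemma set_subst: "set (subst \<phi> w) = (\<Union>x\<in>set w. set (\<phi> x))"
  by (induction w) auto

lemma subst_select: "subst (\<lambda>y. if y = x then [z] else []) w = replicate (count_list w x) z"
  by (induction w) auto

lemma subst_replicate: "subst \<phi> (replicate n x) = concat (replicate n (\<phi> x))"
  by (induction n) auto

abbreviation raise :: "nat \<Rightarrow> word \<Rightarrow> word" where
  "raise n \<equiv> subst (replicate n)"

lemma set_raise: "n \<ge> 1 \<Longrightarrow> set (raise n w) = set w"
  by (auto simp: set_subst)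

lemma subst_raise: "subst \<psi> (raise n w) = subst (\<lambda>x. concat (replicate n (\<psi> x))) w"
  by (simp add: subst_subst subst_replicate)

locale fully_invariant_congruence =
  fixes \<theta> :: "(word \<times> word) set"
  assumes refl: "(u, u) \<in> \<theta>"
    and sym: "(u, v) \<in> \<theta> \<Longrightarrow> (v, u) \<in> \<theta>"
    and trans: "(u, v) \<in> \<theta> \<Longrightarrow> (v, w) \<in> \<theta> \<Longrightarrow> (u, w) \<in> \<theta>"
    and append_context: "(u, v) \<in> \<theta> \<Longrightarrow> (c @ u @ d, c @ v @ d) \<in> \<theta>"
    and subst: "(u, v) \<in> \<theta> \<Longrightarrow> (subst \<phi> u, subst \<phi> v) \<in> \<theta>"
begin

lemma append: "(u, v) \<in> \<theta> \<Longrightarrow> (u', v') \<in> \<theta> \<Longrightarrow> (u @ u', v @ v') \<in> \<theta>"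
  using append_context[of u v "[]" u'] append_context[of u' v' v "[]"] trans by auto

lemma subst_pointwise: "(\<And>x. (\<phi> x, \<psi> x) \<in> \<theta>) \<Longrightarrow> (subst \<phi> w, subst \<psi> w) \<in> \<theta>"
  by (induction w) (auto intro: refl append)

lemma letter_identity: "(replicate i 0, replicate j 0) \<in> \<theta> \<Longrightarrow> (replicate i x, replicate j x) \<in> \<theta>"
  using subst[of "replicate i 0" "replicate j 0" "\<lambda>_. [x]"] by simp

lemma count_identity:
  "(u, v) \<in> \<theta> \<Longrightarrow> (replicate (count_list u x) 0, replicate (count_list v x) 0) \<in> \<theta>"
  using subst[of u v "\<lambda>y. if y = x then [0] else []"] by (simp add: subst_select)

lemma raise_equivalent:
  assumes "([0], replicate n 0) \<in> \<theta>"
  shows "(w, raise n w) \<in> \<theta>"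
proof -
  have "([x], replicate n x) \<in> \<theta>" for x using letter_identity[of 1 n x] assms by simp
  from subst_pointwise[where \<phi> = "\<lambda>x. [x]" and w = w, OF this] show ?thesis by simp
qed

text \<open>Read for groups of exponent \<open>n\<close>: an \<open>n\<close>-th power may be inserted anywhere. This makes it possible
  to add letters to the words of a chain.\<close>
lemma raise_equivalent_Nil:
  assumes "([], replicate n 0) \<in> \<theta>"
  shows "([], raise n w) \<in> \<theta>"
proof -
  have "([], replicate n x) \<in> \<theta>" for x using letter_identity[of 0 n x] assms by simp
  from subst_pointwise[where \<phi> = "\<lambda>x. []" and w = w, OF this] show ?thesis by (simp add: subst_eq_Nil[THEN iffD2])
qed

lemma Nil_power:
  assumes "([], replicate n 0) \<in> \<theta>"
  shows "([], replicate (n * k) 0) \<in> \<theta>"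
proof (induction k)
  case (Suc k)
  from append[OF assms this] show ?case by (simp add: replicate_add)
qed (simp add: refl)

text \<open>A letter that occurs on one side only survives, with its multiplicity, when all the other letters
  are deleted, and the other side becomes empty.\<close>
lemma content_change_imp_periodic:
  assumes "(u, v) \<in> \<theta>" and "set u \<noteq> set v"
  obtains n where "n \<ge> 1" and "([], replicate n 0) \<in> \<theta>"
proof -
  have *: "\<exists>n\<ge>1. ([], replicate n 0) \<in> \<theta>" if "(p, q) \<in> \<theta>" "x \<in> set p" "x \<notin> set q" for p q x
  proof -
    have "count_list p x \<ge> 1" using that(2) by (metis count_list_0_iff less_one not_less)
    moreover have "([], replicate (count_list p x) 0) \<in> \<theta>"
      using count_identity[OF sym[OF that(1)], of x] that(3) by simp
    ultimately show ?thesis by blast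
  qed
  from assms(2) obtain x where "x \<in> set u \<and> x \<notin> set v \<or> x \<in> set v \<and> x \<notin> set u" by blast
  then have "\<exists>n\<ge>1. ([], replicate n 0) \<in> \<theta>" using * assms(1) sym by blast
  then show thesis using that by blast
qed

end

lemma fully_invariant_Int:
  assumes "fully_invariant_congruence \<alpha>" "fully_invariant_congruence \<beta>"
  shows "fully_invariant_congruence (\<alpha> \<inter> \<beta>)"
proof -
  interpret \<alpha>: fully_invariant_congruence \<alpha> by fact
  interpret \<beta>: fully_invariant_congruence \<beta> by fact
  show ?thesis
    by standard (auto intro: \<alpha>.refl \<beta>.refl \<alpha>.sym \<beta>.sym \<alpha>.append_context \<beta>.append_context
      \<alpha>.subst \<beta>.subst dest: \<alpha>.trans \<beta>.trans)
qed

lemma fully_invariant_rtrancl: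
  assumes sym: "\<And>u v. (u, v) \<in> R \<Longrightarrow> (v, u) \<in> R"
    and ctx: "\<And>u v c d. (u, v) \<in> R \<Longrightarrow> (c @ u @ d, c @ v @ d) \<in> R"
    and subst: "\<And>u v \<phi>. (u, v) \<in> R \<Longrightarrow> (subst \<phi> u, subst \<phi> v) \<in> R"
  shows "fully_invariant_congruence (R\<^sup>*)"
proof
  fix u v c d :: word and \<phi>
  assume uv: "(u, v) \<in> R\<^sup>*"
  show "(v, u) \<in> R\<^sup>*" using sym uv by (metis symI sym_rtrancl symD)
  show "(c @ u @ d, c @ v @ d) \<in> R\<^sup>*"
    using uv by (induction rule: rtrancl_induct) (auto intro: rtrancl.rtrancl_into_rtrancl ctx)
  show "(subst \<phi> u, subst \<phi> v) \<in> R\<^sup>*"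
    using uv by (induction rule: rtrancl_induct) (auto intro: rtrancl.rtrancl_into_rtrancl subst)
qed auto

lemma fully_invariant_join:
  assumes "fully_invariant_congruence \<alpha>" "fully_invariant_congruence \<beta>"
  shows "fully_invariant_congruence ((\<alpha> \<union> \<beta>)\<^sup>*)"
proof -
  interpret \<alpha>: fully_invariant_congruence \<alpha> by fact
  interpret \<beta>: fully_invariant_congruence \<beta> by fact
  show ?thesis
    by (rule fully_invariant_rtrancl)
       (auto intro: \<alpha>.sym \<beta>.sym \<alpha>.append_context \<beta>.append_context \<alpha>.subst \<beta>.subst)
qed

lemma (in fully_invariant_congruence) rtrancl_subset_congruence:
  assumes "R \<subseteq> \<theta>"
  shows "R\<^sup>* \<subseteq> \<theta>"
proof
  fix p assume "p \<in> R\<^sup>*"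
  moreover have "(u, v) \<in> \<theta>" if "(u, v) \<in> R\<^sup>*" for u v
    using that assms by induction (auto intro: refl trans)
  ultimately show "p \<in> \<theta>" by (cases p) blast
qed

text \<open>The elementary steps of equational deduction: one application, in either direction, of an identity
  of \<open>\<Sigma>\<close> inside a word. Substitutions may delete letters, so an instance need not be as long as the
  identity itself.\<close>
definition instances :: "(word \<times> word) set \<Rightarrow> (word \<times> word) set" where
  "instances \<Sigma> = {(c @ subst \<psi> s @ d, c @ subst \<psi> t @ d) | c d \<psi> s t. (s, t) \<in> \<Sigma> \<or> (t, s) \<in> \<Sigma>}"

lemma instancesI: "(s, t) \<in> \<Sigma> \<or> (t, s) \<in> \<Sigma> \<Longrightarrow> (c @ subst \<psi> s @ d, c @ subst \<psi> t @ d) \<in> instances \<Sigma>"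
  unfolding instances_def by blast

lemma instancesE:
  assumes "(u, v) \<in> instances \<Sigma>"
  obtains c d \<psi> s t where "u = c @ subst \<psi> s @ d" "v = c @ subst \<psi> t @ d" "(s, t) \<in> \<Sigma> \<or> (t, s) \<in> \<Sigma>"
  using assms unfolding instances_def by blast

definition generated :: "(word \<times> word) set \<Rightarrow> (word \<times> word) set" where
  "generated \<Sigma> = (instances \<Sigma>)\<^sup>*"

lemma generated_fully_invariant: "fully_invariant_congruence (generated \<Sigma>)"
  unfolding generated_def
proof (rule fully_invariant_rtrancl)
  fix u v c d :: word and \<phi>
  assume "(u, v) \<in> instances \<Sigma>"
  then obtain c' d' \<psi> s t where
    *: "u = c' @ subst \<psi> s @ d'" "v = c' @ subst \<psi> t @ d'" "(s, t) \<in> \<Sigma> \<or> (t, s) \<in> \<Sigma>"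
    by (rule instancesE)
  show "(v, u) \<in> instances \<Sigma>" using * by (auto intro: instancesI)
  show "(c @ u @ d, c @ v @ d) \<in> instances \<Sigma>"
    using instancesI[OF *(3), of "c @ c'" \<psi> "d' @ d"] * by simp
  show "(subst \<phi> u, subst \<phi> v) \<in> instances \<Sigma>"
    using instancesI[OF *(3), of "subst \<phi> c'" "\<lambda>x. subst \<phi> (\<psi> x)" "subst \<phi> d'"] *
    by (simp add: subst_subst)
qed

lemma generated_contains: "(s, t) \<in> \<Sigma> \<Longrightarrow> (s, t) \<in> generated \<Sigma>"
  using instancesI[of s t \<Sigma> "[]" "\<lambda>x. [x]" "[]"] by (auto simp: generated_def)

lemma (in fully_invariant_congruence) generated_subset:
  assumes "\<Sigma> \<subseteq> \<theta>"
  shows "generated \<Sigma> \<subseteq> \<theta>"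
  unfolding generated_def
proof (rule rtrancl_subset_congruence)
  show "instances \<Sigma> \<subseteq> \<theta>"
    using assms by (auto simp: instances_def intro!: append_context subst intro: sym)
qed

section \<open>Varieties and their identities\<close>

definition identities :: "'a monoid_variety \<Rightarrow> (word \<times> word) set" where
  "identities V = {(u, v). \<forall>M\<in>members V. satisfies M u v}"

lemma members_eq_models: obtains \<Sigma> where "members V = models \<Sigma>"
  using members[of V] by blast

lemma members_monoid: "M \<in> members V \<Longrightarrow> monoid M"
  using members_eq_models[of V] by (auto simp: models_def)

lemma eval_word_subst:
  assumes "monoid M" "range \<phi> \<subseteq> carrier M"
  shows "eval_word M \<phi> (subst \<psi> w) = eval_word M (\<lambda>x. eval_word M \<phi> (\<psi> x)) w"
  by (induction w) (simp_all add: eval_word_append[OF assms])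

lemma identities_fully_invariant:
  fixes V :: "'a monoid_variety"
  shows "fully_invariant_congruence (identities V)"
proof
  fix u v c d :: word and \<psi>
  assume uv: "(u, v) \<in> identities V"
  show "(c @ u @ d, c @ v @ d) \<in> identities V"
    using uv by (auto simp: identities_def satisfies_def eval_word_append members_monoid)
  show "(subst \<psi> u, subst \<psi> v) \<in> identities V"
    unfolding identities_def satisfies_def
  proof safe
    fix M and \<phi> :: "nat \<Rightarrow> 'a" assume M: "M \<in> members V" and \<phi>: "range \<phi> \<subseteq> carrier M"
    have "range (\<lambda>x. eval_word M \<phi> (\<psi> x)) \<subseteq> carrier M"
      using eval_word_closed[OF members_monoid[OF M] \<phi>] by blast
    then show "eval_word M \<phi> (subst \<psi> u) = eval_word M \<phi> (subst \<psi> v)"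
      using uv M by (simp add: eval_word_subst[OF members_monoid[OF M] \<phi>] identities_def satisfies_def)
  qed
qed (auto simp: identities_def satisfies_def)

lemma le_iff_identities: "V \<le> W \<longleftrightarrow> identities W \<subseteq> identities V"
proof
  assume "V \<le> W"
  then show "identities W \<subseteq> identities V"
    by (auto simp: less_eq_monoid_variety.rep_eq identities_def)
next
  assume *: "identities W \<subseteq> identities V"
  obtain \<Sigma> where \<Sigma>: "members W = models \<Sigma>" by (rule members_eq_models)
  then have "\<Sigma> \<subseteq> identities W" by (auto simp: identities_def models_def)
  with * have "\<Sigma> \<subseteq> identities V" by blast
  then show "V \<le> W"
    by (auto simp: less_eq_monoid_variety.rep_eq \<Sigma> models_def members_monoid identities_def)
qed

text \<open>The relatively free monoid separates \<open>u\<close> from \<open>v\<close>. Its elements are taken to be chosen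
  representatives of the congruence classes rather than the classes, so that it lives on words.\<close>
lemma (in fully_invariant_congruence) non_identity_fails_in_quotient:
  assumes "(u, v) \<notin> \<theta>"
  shows "\<exists>M \<in> models \<theta> :: word monoid set. \<not> satisfies M u v"
proof -
  define r where "r w = (SOME v. (w, v) \<in> \<theta>)" for w
  have r: "(w, r w) \<in> \<theta>" for w unfolding r_def by (rule someI[of _ w]) (rule refl)
  have r_eq: "r p = r q \<longleftrightarrow> (p, q) \<in> \<theta>" for p q
  proof
    assume "r p = r q" then show "(p, q) \<in> \<theta>" using r sym trans by metis
  next
    assume pq: "(p, q) \<in> \<theta>"
    then have "(\<lambda>v. (p, v) \<in> \<theta>) = (\<lambda>v. (q, v) \<in> \<theta>)" using sym trans by blast
    then show "r p = r q" by (simp add: r_def)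
  qed
  define M :: "word monoid" where "M = \<lparr>carrier = range r, monoid.mult = \<lambda>p q. r (p @ q), one = r []\<rparr>"
  have M: "carrier M = range r" "\<And>p q. p \<otimes>\<^bsub>M\<^esub> q = r (p @ q)" "\<one>\<^bsub>M\<^esub> = r []"
    by (simp_all add: M_def)
  have rr: "r (r p) = r p" for p using r_eq r sym by blast
  have rl: "r (r p @ q) = r (p @ q)" for p q using r_eq append[OF r refl] sym by blast
  have rR: "r (p @ r q) = r (p @ q)" for p q using r_eq append[OF refl r] sym by blast
  have mon: "monoid M"
    by (rule monoidI) (auto simp: M rl rR rr)
  have ev: "eval_word M \<phi> w = r (subst \<phi> w)" for \<phi> w
    by (induction w) (simp_all add: M rR)
  have "satisfies M s t" if "(s, t) \<in> \<theta>" for s t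
    using that by (auto simp: satisfies_def ev r_eq subst)
  with mon have "M \<in> models \<theta>" by (auto simp: models_def)
  moreover have "\<not> satisfies M u v"
  proof
    assume "satisfies M u v"
    moreover have "range (\<lambda>x. r [x]) \<subseteq> carrier M" by (auto simp: M)
    ultimately have "r (subst (\<lambda>x. r [x]) u) = r (subst (\<lambda>x. r [x]) v)"
      unfolding satisfies_def ev[symmetric] by blast
    then have "(subst (\<lambda>x. r [x]) u, subst (\<lambda>x. r [x]) v) \<in> \<theta>"
      by (simp add: r_eq)
    moreover have "(w, subst (\<lambda>x. r [x]) w) \<in> \<theta>" for w
      using subst_pointwise[of "\<lambda>x. [x]" "\<lambda>x. r [x]" w] r by simp
    ultimately show False using assms sym trans by blast
  qed
  ultimately show ?thesis by blast
qed

text \<open>Completeness of equational deduction. The separating monoid of the previous lemma lives on words;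
  that the universe is infinite serves to move it there.\<close>
lemma identities_surj:
  assumes inf: "infinite (UNIV :: 'a set)" and "fully_invariant_congruence \<theta>"
  obtains V :: "'a monoid_variety" where "identities V = \<theta>"
proof
  interpret fully_invariant_congruence \<theta> by fact
  define V :: "'a monoid_variety" where "V = variety_of_members (models \<theta>)"
  have V: "members V = models \<theta>" unfolding V_def by (rule variety_of_members_inverse) simp
  have "(u, v) \<in> \<theta>" if uv: "(u, v) \<in> identities V" for u v
  proof (rule ccontr)
    assume "(u, v) \<notin> \<theta>"
    then obtain M where M: "M \<in> (models \<theta> :: word monoid set)" "\<not> satisfies M u v"
      using non_identity_fails_in_quotient by blast
    have "(models \<theta> :: 'a monoid set) \<subseteq> models {(u, v)}"
      using uv V by (auto simp: identities_def models_def)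
    from models_subset_transfer[OF inf this] M show False by (auto simp: models_def)
  qed
  then show "identities V = \<theta>" by (auto simp: identities_def V models_def)
qed

lemma identities_sup:
  fixes V W :: "'a monoid_variety"
  assumes "infinite (UNIV :: 'a set)"
  shows "identities (sup V W) = identities V \<inter> identities W"
proof
  show "identities (sup V W) \<subseteq> identities V \<inter> identities W"
    by (simp flip: le_iff_identities)
  obtain U :: "'a monoid_variety" where U: "identities U = identities V \<inter> identities W"
    by (rule identities_surj[OF assms fully_invariant_Int[OF identities_fully_invariant identities_fully_invariant]])
  then have "V \<le> U" "W \<le> U" by (auto simp: le_iff_identities)
  then have "sup V W \<le> U" by simp
  then show "identities V \<inter> identities W \<subseteq> identities (sup V W)" by (simp add: le_iff_identities U)
qed

lemma identities_inf:
  fixes V W :: "'a monoid_variety"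
  assumes "infinite (UNIV :: 'a set)"
  shows "identities (inf V W) = (identities V \<union> identities W)\<^sup>*"
proof
  interpret fully_invariant_congruence "identities (inf V W)" by (rule identities_fully_invariant)
  have "identities V \<subseteq> identities (inf V W)" "identities W \<subseteq> identities (inf V W)"
    by (simp_all flip: le_iff_identities)
  then show "(identities V \<union> identities W)\<^sup>* \<subseteq> identities (inf V W)"
    by (intro rtrancl_subset_congruence) blast
  obtain U :: "'a monoid_variety" where U: "identities U = (identities V \<union> identities W)\<^sup>*"
    by (rule identities_surj[OF assms fully_invariant_join[OF identities_fully_invariant identities_fully_invariant]])
  then have "U \<le> V" "U \<le> W" by (auto simp: le_iff_identities)
  then have "U \<le> inf V W" by simp
  then show "identities (inf V W) \<subseteq> (identities V \<union> identities W)\<^sup>*" by (simp add: le_iff_identities U)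
qed

text \<open>The definitions of modular and lower-modular elements, read in the dual lattice of congruences.\<close>
lemma modular_identities:
  fixes V :: "'a monoid_variety"
  assumes inf: "infinite (UNIV :: 'a set)" and "modular_element V"
    and \<beta>: "fully_invariant_congruence \<beta>" and \<gamma>: "fully_invariant_congruence \<gamma>" and "\<gamma> \<subseteq> \<beta>"
  shows "(identities V \<union> \<gamma>)\<^sup>* \<inter> \<beta> = ((identities V \<inter> \<beta>) \<union> \<gamma>)\<^sup>*"
proof -
  obtain Y :: "'a monoid_variety" where Y: "identities Y = \<beta>"
    by (rule identities_surj[OF inf \<beta>])
  obtain Z :: "'a monoid_variety" where Z: "identities Z = \<gamma>"
    by (rule identities_surj[OF inf \<gamma>])
  note YZ = Y Z
  then have "Y \<le> Z" using \<open>\<gamma> \<subseteq> \<beta>\<close> by (simp add: le_iff_identities)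
  then have "inf (sup V Y) Z = sup (inf V Z) Y"
    using assms(2) unfolding modular_element_def by blast
  from arg_cong[OF this[symmetric], of identities] show ?thesis
    by (simp add: YZ identities_sup[OF inf] identities_inf[OF inf])
qed

lemma lower_modular_identities:
  fixes V :: "'a monoid_variety"
  assumes inf: "infinite (UNIV :: 'a set)" and "lower_modular_element V"
    and \<beta>: "fully_invariant_congruence \<beta>" and \<gamma>: "fully_invariant_congruence \<gamma>"
    and "\<beta> \<subseteq> identities V"
  shows "identities V \<inter> (\<beta> \<union> \<gamma>)\<^sup>* = (\<beta> \<union> (identities V \<inter> \<gamma>))\<^sup>*"
proof -
  obtain Y :: "'a monoid_variety" where Y: "identities Y = \<beta>"
    by (rule identities_surj[OF inf \<beta>])
  obtain Z :: "'a monoid_variety" where Z: "identities Z = \<gamma>"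
    by (rule identities_surj[OF inf \<gamma>])
  note YZ = Y Z
  then have "V \<le> Y" using \<open>\<beta> \<subseteq> identities V\<close> by (simp add: le_iff_identities)
  then have "sup V (inf Y Z) = inf Y (sup V Z)"
    using assms(2) unfolding lower_modular_element_def by blast
  from arg_cong[OF this, of identities] show ?thesis
    by (simp add: YZ identities_sup[OF inf] identities_inf[OF inf])
qed

section \<open>Identities of finite symmetric groups\<close>

text \<open>A partial injection of a finite set extends to a permutation, because the complements of its domain
  and of its range have the same size.\<close>
lemma extend_to_permutation:
  assumes "finite S" "D \<subseteq> S" "inj_on g D" "g ` D \<subseteq> S"
  obtains p where "p permutes S" "\<And>x. x \<in> D \<Longrightarrow> p x = g x"
proof -
  have "finite D" using assms(1,2) by (rule rev_finite_subset)
  then have "card (S - D) = card (S - g ` D)"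
    using assms(2-4) by (simp add: card_Diff_subset card_image)
  then obtain h where h: "bij_betw h (S - D) (S - g ` D)"
    using assms(1) by (meson finite_Diff finite_same_card_bij)
  define p where "p x = (if x \<in> D then g x else if x \<in> S then h x else x)" for x
  have "bij_betw p D (g ` D)"
    using assms(3) by (auto simp: p_def bij_betw_def inj_on_def)
  moreover have "bij_betw p (S - D) (S - g ` D)"
    using h by (rule bij_betw_cong[THEN iffD1, rotated]) (auto simp: p_def)
  ultimately have "bij_betw p (D \<union> (S - D)) (g ` D \<union> (S - g ` D))"
    by (rule bij_betw_combine) blast
  moreover have "D \<union> (S - D) = S" "g ` D \<union> (S - g ` D) = S" using assms by auto
  ultimately have "bij_betw p S S" by simp
  then have "p permutes S" by (rule bij_imp_permutes) (use assms(2) in \<open>auto simp: p_def\<close>)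
  then show thesis by (rule that) (simp add: p_def)
qed

lemma common_exponent_of_permutations:
  assumes "finite S"
  obtains e where "e \<ge> 1" "\<And>p. p permutes S \<Longrightarrow> p ^^ e = id"
proof -
  have "\<exists>n. n > 0 \<and> p ^^ n = id" if "p permutes S" for p
  proof -
    have "p ^^ k permutes S" for k 
      using that by (induction k) (auto intro: permutes_compose simp: permutes_id[unfolded id_def] id_def)
    then have "range (\<lambda>k. p ^^ k) \<subseteq> {q. q permutes S}" by blast
    then have "finite (range (\<lambda>k. p ^^ k))"
      using finite_permutations[OF assms] by (rule finite_subset)
    then have "\<not> inj (\<lambda>k. p ^^ k)" using finite_imageD infinite_UNIV_nat by blast
    then obtain i j where ij: "i < j" "p ^^ i = p ^^ j"
      unfolding inj_def by (metis linorder_neqE_nat)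
    have "inj (p ^^ i)" using that by (intro inj_fn permutes_inj)
    moreover have "(p ^^ i) ((p ^^ (j - i)) x) = (p ^^ i) x" for x
      using ij by (metis add_diff_inverse_nat comp_apply funpow_add less_imp_not_less)
    ultimately have "p ^^ (j - i) = id" by (auto simp: fun_eq_iff dest: injD)
    then show ?thesis using ij(1) by (intro exI[of _ "j - i"]) simp
  qed
  then obtain o' where o': "\<And>p. p permutes S \<Longrightarrow> o' p > 0 \<and> p ^^ o' p = id" by metis
  define e where "e = (\<Prod>p | p permutes S. o' p)"
  have fin: "finite {p. p permutes S}" using assms by (rule finite_permutations)
  have "e > 0" unfolding e_def by (rule prod_pos) (use o' in auto)
  then have "e \<ge> 1" by simp
  moreover have "p ^^ e = id" if "p permutes S" for p
  proof -
    have "o' p dvd e" unfolding e_def using fin that by (intro dvd_prodI) auto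
    then obtain k where "e = o' p * k" by blast
    then have "p ^^ e = (p ^^ o' p) ^^ k" by (simp add: funpow_mult)
    then show ?thesis using o'[OF that] by simp
  qed
  ultimately show thesis by (rule that)
qed

text \<open>The identities of the symmetric group on \<open>S\<close>, acting from the right: a word acts letter by letter
  from left to right, which is \<open>fold\<close>.\<close>
definition permutation_identities :: "'s set \<Rightarrow> (word \<times> word) set" where
  "permutation_identities S = {(u, v). \<forall>f. (\<forall>i. f i permutes S) \<longrightarrow> fold f u = fold f v}"

lemma fold_subst: "fold f (subst \<phi> w) = fold (\<lambda>x. fold f (\<phi> x)) w"
  by (induction w) auto

lemma fold_permutes: "(\<And>i. f i permutes S) \<Longrightarrow> fold f w permutes S"
  by (induction w) (auto simp: permutes_id[unfolded id_def] id_def intro: permutes_compose)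

lemma permutation_identities_fully_invariant:
  "fully_invariant_congruence (permutation_identities S)"
proof
  fix u v c d :: word and \<phi>
  assume uv: "(u, v) \<in> permutation_identities S"
  then show "(c @ u @ d, c @ v @ d) \<in> permutation_identities S"
    by (simp add: permutation_identities_def)
  show "(subst \<phi> u, subst \<phi> v) \<in> permutation_identities S"
    using uv fold_permutes unfolding permutation_identities_def by (fastforce simp: fold_subst)
qed (auto simp: permutation_identities_def)

lemma permutation_identities_power:
  assumes "\<And>p. p permutes S \<Longrightarrow> p ^^ e = id"
  shows "([0], replicate (Suc (e * k)) 0) \<in> permutation_identities S"
proof -
  have "fold f (replicate n x) = f x ^^ n" for f :: "nat \<Rightarrow> 's \<Rightarrow> 's" and n x
    by (induction n) (auto simp: funpow_swap1 fun_eq_iff)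
  moreover have "p ^^ (e * k) = id" if "p permutes S" for p
    using assms[OF that] by (metis funpow_mult id_funpow)
  ultimately show ?thesis
    by (simp add: permutation_identities_def del: replicate_Suc funpow.simps add: replicate_Suc[symmetric])
       (simp add: fun_eq_iff)
qed

text \<open>Free groups are residually finite; for positive words the proof is short. Let \<open>S\<close> consist of the
  prefixes of \<open>u\<close> and \<open>v\<close>. Appending the letter \<open>i\<close> is a partial injection of \<open>S\<close>, so it extends to a
  permutation. Under these permutations \<open>u\<close> sends the empty prefix to \<open>u\<close>, and \<open>v\<close> sends it to \<open>v\<close>.\<close>
lemma permutation_identities_separate:
  fixes u v :: word
  assumes "u \<noteq> v"
  obtains S :: "word set" where "finite S" "(u, v) \<notin> permutation_identities S"
proof
  define S where "S = set (prefixes u) \<union> set (prefixes v)"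
  show fin: "finite S" by (simp add: S_def)
  have pre: "p \<in> S" if "p @ q = u \<or> p @ q = v" for p q
    using that by (auto simp: S_def)
  have "\<exists>p. p permutes S \<and> (\<forall>w. w @ [i] \<in> S \<and> w \<in> S \<longrightarrow> p w = w @ [i])" for i
  proof -
    obtain p where "p permutes S" "\<And>w. w \<in> {w \<in> S. w @ [i] \<in> S} \<Longrightarrow> p w = w @ [i]"
      by (rule extend_to_permutation[OF fin, of "{w \<in> S. w @ [i] \<in> S}" "\<lambda>w. w @ [i]"])
         (auto simp: inj_on_def)
    then show ?thesis by blast
  qed
  then have "\<exists>f. \<forall>i. f i permutes S \<and> (\<forall>w. w @ [i] \<in> S \<and> w \<in> S \<longrightarrow> f i w = w @ [i])"
    by (rule choice[OF allI])
  then obtain f where f: "\<And>i. f i permutes S" "\<And>i w. w @ [i] \<in> S \<Longrightarrow> w \<in> S \<Longrightarrow> f i w = w @ [i]"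
    by blast
  have "fold f q p = p @ q" if "p @ q = u \<or> p @ q = v" for p q
    using that
  proof (induction q arbitrary: p)
    case (Cons x q)
    then have "f x p = p @ [x]" by (intro f(2)) (rule pre[of _ q] pre[of _ "x # q"], simp)+
    then show ?case using Cons.IH[of "p @ [x]"] Cons.prems by simp
  qed simp
  from this[of "[]"] have "fold f u [] \<noteq> fold f v []" using assms by simp
  then have "fold f u \<noteq> fold f v" by auto
  then show "(u, v) \<notin> permutation_identities S" using f(1) unfolding permutation_identities_def by blast
qed

section \<open>Lower-modular varieties\<close>

text \<open>Words over a single letter commute, so the image depends only on the multiplicities in \<open>a\<close>.\<close>
lemma subst_eq_over_one_letter:
  assumes "mset a = mset b" and one: "\<And>x. x \<in> set a \<Longrightarrow> set (\<psi> x) \<subseteq> {z}"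
  shows "subst \<psi> a = subst \<psi> b"
proof -
  have *: "subst \<psi> w = replicate (\<Sum>x\<in>#mset w. length (\<psi> x)) z" if "set w \<subseteq> set a" for w
    using that
  proof (induction w)
    case (Cons x w)
    have "\<psi> x = replicate (length (\<psi> x)) z"
      using one[of x] Cons.prems by (intro replicate_eqI) auto
    then have "subst \<psi> (x # w) = replicate (length (\<psi> x)) z @ subst \<psi> w" by simp
    also have "subst \<psi> w = replicate (\<Sum>x\<in>#mset w. length (\<psi> x)) z"
      using Cons by simp
    finally show ?case by (simp add: replicate_add)
  qed simp
  have "set b = set a" using assms(1) by (metis set_mset_mset)
  then show ?thesis using *[of a] *[of b] assms(1) by simp
qed

lemma count_list_replicate: "count_list (replicate n x) y = (if x = y then n else 0)"
  by (induction n) auto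

lemma count_list_concat_replicate: "count_list (concat (replicate n u)) y = n * count_list u y"
  by (induction n) auto

lemma count_list_subst_raise:
  "x \<in> set w \<Longrightarrow> n * count_list (\<psi> x) y \<le> count_list (subst \<psi> (raise n w)) y"
  unfolding subst_raise by (induction w) (auto simp: count_list_concat_replicate)

text \<open>The \<open>n\<close>-th power of the image of a letter occurs in \<open>w\<close>, so the image contains only the letter \<open>z\<close>.
  Hence every application of the raised identity to \<open>w\<close> leaves \<open>w\<close> unchanged.\<close>
lemma bounded_class_isolated:
  assumes ab: "mset a = mset b" and N: "\<And>y. y \<noteq> z \<Longrightarrow> count_list w y < n"
    and gen: "(w, w') \<in> generated {(raise n a, raise n b)}"
  shows "w' = w"
  using gen unfolding generated_def
proof (induction rule: rtrancl_induct)
  case (step v v')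
  from step(2) obtain c d \<psi> s t where w: "v = c @ subst \<psi> s @ d" "v' = c @ subst \<psi> t @ d"
    and st: "(s, t) \<in> {(raise n a, raise n b)} \<or> (t, s) \<in> {(raise n a, raise n b)}"
    by (rule instancesE)
  then obtain p q where pq: "s = raise n p" "t = raise n q" "mset p = mset q"
    using ab by auto
  have "set (concat (replicate n (\<psi> x))) \<subseteq> {z}" if x: "x \<in> set p" for x
  proof -
    have "y \<notin> set (\<psi> x)" if "y \<noteq> z" for y
    proof -
      have "n * count_list (\<psi> x) y \<le> count_list w y"
        using count_list_subst_raise[OF x, of n \<psi> y] w(1) step.IH by (simp add: pq)
      also have "\<dots> < n * 1" using N[OF that] by simp
      finally show ?thesis by (simp add: count_list_0_iff)
    qed
    then have "set (\<psi> x) \<subseteq> {z}" by (auto simp: count_list_0_iff)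
    then show ?thesis by auto
  qed
  then have "subst \<psi> s = subst \<psi> t"
    unfolding pq subst_raise by (rule subst_eq_over_one_letter[OF pq(3)])
  then show ?case using w step.IH by simp
qed simp

text \<open>The key consequence of lower-modularity. Take the congruence \<open>\<beta>\<close> generated by the raised identity,
  which consists of identities of \<open>V\<close>, and the identities \<open>\<gamma>\<close> of a finite group. Since \<open>x = x^n\<close>
  holds in the group for suitable \<open>n\<close>, the pair \<open>(a, b)\<close> lies in the join of \<open>\<beta>\<close> and \<open>\<gamma>\<close>. By
  lower-modularity, \<open>a\<close> and \<open>b\<close> are then connected by steps from \<open>\<beta>\<close> and from the common
  identities of \<open>V\<close> and the group; all words on the way are equal to \<open>a\<close> in \<open>V\<close>, so \<open>\<beta>\<close> does not
  move them. Thus \<open>a = b\<close> would hold in the group, which was chosen to separate the two words.\<close>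
lemma lower_modular_no_bounded_class:
  fixes V :: "'a monoid_variety"
  assumes inf: "infinite (UNIV :: 'a set)" and lm: "lower_modular_element V"
    and ab: "(a, b) \<in> identities V" "mset a = mset b"
    and bounded: "\<And>w y. (a, w) \<in> identities V \<Longrightarrow> y \<noteq> z \<Longrightarrow> count_list w y \<le> N"
  shows "a = b"
proof (rule ccontr)
  assume "a \<noteq> b"
  then obtain S :: "word set" where S: "finite S" "(a, b) \<notin> permutation_identities S"
    by (rule permutation_identities_separate)
  obtain e where e: "e \<ge> 1" "\<And>p. p permutes S \<Longrightarrow> p ^^ e = id"
    using common_exponent_of_permutations[OF S(1)] by blast
  \<comment> \<open>The exponent has to be a multiple of \<open>e\<close> plus one, for \<open>x = x^n\<close> in the group, and to exceed the bound \<open>N\<close>.\<close>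
  define n where "n = Suc (e * Suc N)"
  have n: "N < n" using mult_le_mono1[OF e(1), of "Suc N"] by (simp add: n_def)
  define \<gamma> where "\<gamma> = permutation_identities S"
  define \<beta> where "\<beta> = generated {(raise n a, raise n b)}"
  interpret \<theta>: fully_invariant_congruence "identities V" by (rule identities_fully_invariant)
  interpret \<gamma>: fully_invariant_congruence \<gamma>
    unfolding \<gamma>_def by (rule permutation_identities_fully_invariant)
  have \<beta>: "fully_invariant_congruence \<beta>" unfolding \<beta>_def by (rule generated_fully_invariant)
  have "\<beta> \<subseteq> identities V"
    unfolding \<beta>_def by (rule \<theta>.generated_subset) (use \<theta>.subst[OF ab(1)] in auto)
  have power: "(w, raise n w) \<in> \<gamma>" for w
    by (rule \<gamma>.raise_equivalent) (unfold \<gamma>_def n_def, rule permutation_identities_power[OF e(2)])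
  have "(a, raise n a) \<in> \<beta> \<union> \<gamma>" "(raise n a, raise n b) \<in> \<beta> \<union> \<gamma>" "(raise n b, b) \<in> \<beta> \<union> \<gamma>"
    using power \<gamma>.sym by (auto simp: \<beta>_def intro: generated_contains)
  then have "(a, b) \<in> identities V \<inter> (\<beta> \<union> \<gamma>)\<^sup>*"
    using ab(1) by (meson IntI r_into_rtrancl rtrancl_trans)
  then have "(a, b) \<in> (\<beta> \<union> (identities V \<inter> \<gamma>))\<^sup>*"
    using lower_modular_identities[OF inf lm \<beta> \<gamma>.fully_invariant_congruence_axioms \<open>\<beta> \<subseteq> identities V\<close>]
    by simp
  then have "(a, b) \<in> identities V \<inter> \<gamma>"
  proof (induction rule: rtrancl_induct)
    case base
    show ?case by (simp add: \<theta>.refl \<gamma>.refl)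
  next
    case (step w w')
    have "w' = w" if "(w, w') \<in> \<beta>"
    proof (rule bounded_class_isolated[OF ab(2)])
      show "count_list w y < n" if "y \<noteq> z" for y
        using bounded[of w y] step.IH that n by simp
      show "(w, w') \<in> generated {(raise n a, raise n b)}"
        using that by (simp add: \<beta>_def)
    qed
    then show ?case using step.IH step.hyps(2) \<theta>.trans \<gamma>.trans by blast
  qed
  with S(2) show False by (simp add: \<gamma>_def)
qed

text \<open>If all identities preserve multiplicities, any of them contradicts the previous lemma. Otherwise
  the witness is \<open>x^j t x^k = x^k t x^j\<close>: if no identity \<open>x = x^n\<close> with \<open>n > 1\<close> holds, then the words
  equal to the left-hand side contain \<open>t\<close> once and otherwise only \<open>x\<close>, here the letters \<open>1\<close> and \<open>0\<close>.\<close>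
lemma lower_modular_imp_completely_regular:
  fixes V :: "'a monoid_variety"
  assumes inf: "infinite (UNIV :: 'a set)" and lm: "lower_modular_element V"
    and uv: "(u, v) \<in> identities V" "u \<noteq> v"
  shows "\<exists>n\<ge>2. ([0], replicate n 0) \<in> identities V"
proof (rule ccontr)
  assume "\<not> ?thesis"
  then have not_regular: "n < 2" if "([0], replicate n 0) \<in> identities V" for n
    using that by (meson not_less)
  interpret fully_invariant_congruence "identities V" by (rule identities_fully_invariant)
  show False
  proof (cases "\<forall>(p, q) \<in> identities V. mset p = mset q")
    case True
    have bound: "count_list w y \<le> length u" if "(u, w) \<in> identities V" for w y
    proof -
      have "mset u = mset w" using True that by blast
      then have "length u = length w" by (rule mset_eq_length)
      then show ?thesis using count_le_length[of w y] by simp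
    qed
    have "mset u = mset v" using True uv(1) by blast
    then have "u = v" by (rule lower_modular_no_bounded_class[OF inf lm uv(1)]) (rule bound)
    with uv(2) show False by contradiction
  next
    case False
    then obtain p q where pq: "(p, q) \<in> identities V" "mset p \<noteq> mset q" by blast
    from pq(2) obtain x where "count_list p x \<noteq> count_list q x"
      by (auto simp: multiset_eq_iff count_mset)
    with count_identity[OF pq(1), of x] obtain k j where
      "k < j" and kj: "(replicate k 0, replicate j 0) \<in> identities V"
      using sym by (metis linorder_neqE_nat)
    define a b where "a = replicate j 0 @ [1 :: nat] @ replicate k 0"
      and "b = replicate k 0 @ [1 :: nat] @ replicate j 0"
    have "(a, replicate k 0 @ [1] @ replicate k 0) \<in> identities V"
      unfolding a_def by (intro append sym[OF kj] refl)
    moreover have "(replicate k 0 @ [1] @ replicate k 0, b) \<in> identities V"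
      unfolding b_def by (intro append kj refl)
    ultimately have ab: "(a, b) \<in> identities V" by (rule trans)
    have bound: "count_list w y \<le> 1" if w: "(a, w) \<in> identities V" and "y \<noteq> 0" for w y
    proof (cases "y = 1")
      case True
      then have "count_list a y = 1" by (simp add: a_def count_list_replicate)
      then show ?thesis using count_identity[OF w, of y] not_regular[of "count_list w y"] by simp
    next
      case False
      then have "count_list a y = 0" using \<open>y \<noteq> 0\<close> by (simp add: a_def count_list_replicate)
      \<comment> \<open>From \<open>x^c = 1\<close> follows \<open>x = x^(c + 1)\<close>, which is excluded unless \<open>c = 0\<close>.\<close>
      then have "([0], replicate (Suc (count_list w y)) 0) \<in> identities V"
        using append[OF refl[of "[0]"] count_identity[OF w, of y]] by simp
      from not_regular[OF this] show ?thesis by simp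
    qed
    have "mset a = mset b" by (simp add: a_def b_def)
    then have "a = b" by (rule lower_modular_no_bounded_class[OF inf lm ab]) (rule bound)
    moreover have "a ! k = 0" "b ! k = 1" using \<open>k < j\<close> by (simp_all add: a_def b_def nth_append)
    ultimately show False by simp
  qed
qed

section \<open>Modular varieties\<close>

definition square_free :: "word \<Rightarrow> bool" where
  "square_free w \<longleftrightarrow> (\<forall>p s q. w = p @ s @ s @ q \<longrightarrow> s = [])"

lemma square_freeD: "square_free w \<Longrightarrow> w = p @ s @ s @ q \<Longrightarrow> s = []"
  unfolding square_free_def by blast

text \<open>A finite test, used to verify concrete words by evaluation.\<close>
lemma square_freeI_factors:
  assumes "\<forall>i\<in>set [0..<length w]. \<forall>l\<in>set [1..<Suc (length w)].
    i + 2 * l \<le> length w \<longrightarrow> take l (drop i w) \<noteq> take l (drop (i + l) w)"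
  shows "square_free w"
  unfolding square_free_def
proof (intro allI impI)
  fix p s q assume w: "w = p @ s @ s @ q"
  show "s = []"
  proof (rule ccontr)
    assume "s \<noteq> []"
    then have "length s \<ge> 1" by (cases s) auto
    then have "length p \<in> set [0..<length w]" "length s \<in> set [1..<Suc (length w)]"
        "length p + 2 * length s \<le> length w"
      by (auto simp: w)
    then have "take (length s) (drop (length p) w) \<noteq> take (length s) (drop (length p + length s) w)"
      using assms by blast
    then show False by (simp add: w)
  qed
qed

text \<open>A letter of \<open>a\<close> has its \<open>n\<close>-th power, and so a square, in any instance of \<open>raise n a\<close>. In a
  square-free word such an instance is therefore empty.\<close>
lemma square_free_isolated:
  assumes "n \<ge> 2" "square_free w" "set a = set b" and gen: "(w, w') \<in> generated {(raise n a, raise n b)}"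
  shows "w' = w"
  using gen unfolding generated_def
proof (induction rule: rtrancl_induct)
  case (step v v')
  from step(2) obtain c d \<psi> s t where w: "v = c @ subst \<psi> s @ d" "v' = c @ subst \<psi> t @ d"
    and st: "(s, t) \<in> {(raise n a, raise n b)} \<or> (t, s) \<in> {(raise n a, raise n b)}"
    by (rule instancesE)
  then obtain p q where pq: "s = raise n p" "t = raise n q" "set p = set q"
    using assms(3) by auto
  have "\<psi> x = []" if x: "x \<in> set p" for x
  proof -
    obtain m where m: "n = Suc (Suc m)" using assms(1) by (metis Suc_le_D numeral_2_eq_2 Suc_le_mono)
    obtain p1 p2 where "p = p1 @ x # p2" using x by (meson split_list)
    then have "w = (c @ subst \<psi> (raise n p1)) @ \<psi> x @ \<psi> x @
        (concat (replicate m (\<psi> x)) @ subst \<psi> (raise n p2) @ d)"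
      using w(1) step.IH by (simp add: pq m subst_replicate)
    with assms(2) show ?thesis by (rule square_freeD)
  qed
  then have "subst \<psi> s = []" "subst \<psi> t = []" by (auto simp: pq subst_raise subst_eq_Nil)
  then show ?case using w step.IH by simp
qed simp

text \<open>The key consequence of modularity. Let \<open>\<beta>\<close> be generated by \<open>(a, b)\<close> and \<open>\<gamma>\<close> by the raised pair,
  so that \<open>\<gamma> \<subseteq> \<beta>\<close>. As \<open>x = x^n\<close> holds in \<open>V\<close>, the pair \<open>(a, b)\<close> lies in \<open>\<beta>\<close> and in the join of
  \<open>\<gamma>\<close> with the identities of \<open>V\<close>. By modularity \<open>a\<close> and \<open>b\<close> are connected by steps from \<open>\<gamma>\<close> and
  from those identities of \<open>V\<close> that lie in \<open>\<beta>\<close>. But \<open>\<gamma>\<close> does not move \<open>a\<close>, and the only other word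
  that \<open>\<beta>\<close> relates to \<open>a\<close> is \<open>b\<close>.\<close>
lemma modular_completely_regular_satisfies:
  fixes V :: "'a monoid_variety"
  assumes inf: "infinite (UNIV :: 'a set)" and m: "modular_element V"
    and n: "n \<ge> 2" "([0], replicate n 0) \<in> identities V"
    and a: "square_free a" "set a = set b"
    and rigid: "\<And>w. (a, w) \<in> generated {(a, b)} \<Longrightarrow> w = a \<or> w = b"
  shows "(a, b) \<in> identities V"
proof (rule ccontr)
  assume nab: "(a, b) \<notin> identities V"
  define \<beta> where "\<beta> = generated {(a, b)}"
  define \<gamma> where "\<gamma> = generated {(raise n a, raise n b)}"
  interpret \<theta>: fully_invariant_congruence "identities V" by (rule identities_fully_invariant)
  interpret \<beta>: fully_invariant_congruence \<beta> unfolding \<beta>_def by (rule generated_fully_invariant)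
  have \<gamma>: "fully_invariant_congruence \<gamma>" unfolding \<gamma>_def by (rule generated_fully_invariant)
  have ab: "(a, b) \<in> \<beta>" by (simp add: \<beta>_def generated_contains)
  have "\<gamma> \<subseteq> \<beta>"
    unfolding \<gamma>_def by (rule \<beta>.generated_subset) (use \<beta>.subst[OF ab] in auto)
  have "(a, raise n a) \<in> identities V \<union> \<gamma>" "(raise n a, raise n b) \<in> identities V \<union> \<gamma>"
    "(raise n b, b) \<in> identities V \<union> \<gamma>"
    using \<theta>.raise_equivalent[OF n(2)] \<theta>.sym by (auto simp: \<gamma>_def intro: generated_contains)
  then have "(a, b) \<in> (identities V \<union> \<gamma>)\<^sup>* \<inter> \<beta>"
    using ab by (meson IntI r_into_rtrancl rtrancl_trans)
  then have "(a, b) \<in> ((identities V \<inter> \<beta>) \<union> \<gamma>)\<^sup>*"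
    using modular_identities[OF inf m \<beta>.fully_invariant_congruence_axioms \<gamma> \<open>\<gamma> \<subseteq> \<beta>\<close>] by simp
  then have "b = a"
  proof (induction rule: rtrancl_induct)
    case (step w w')
    then have "(a, w') \<in> (identities V \<inter> \<beta>) \<union> \<gamma>" by simp
    then show ?case
      using rigid[of w'] nab square_free_isolated[OF n(1) a] by (auto simp: \<beta>_def \<gamma>_def)
  qed simp
  with nab show False by (simp add: \<theta>.refl)
qed

lemma generated_closed:
  assumes "\<And>c d \<psi> s t. (s, t) \<in> \<Sigma> \<or> (t, s) \<in> \<Sigma> \<Longrightarrow> c @ subst \<psi> s @ d \<in> S \<Longrightarrow> c @ subst \<psi> t @ d \<in> S"
    and "(w, w') \<in> generated \<Sigma>" "w \<in> S"
  shows "w' \<in> S"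
  using assms(2,3) unfolding generated_def
  by (induction rule: rtrancl_induct) (auto elim!: instancesE intro: assms(1))

lemma commutativity_rigid:
  assumes "([0, 1], w) \<in> generated {([0, 1], [1, 0])}"
  shows "w = [0, 1] \<or> w = [1, 0]"
proof -
  have "w \<in> {w. mset w = {#0, 1#}}"
    by (rule generated_closed[OF _ assms]) (auto simp: ac_simps)
  then have m: "mset w = {#0, 1#}" by simp
  then have "length w = 2" by (metis size_mset size_add_mset size_empty numeral_2_eq_2)
  then obtain x y where "w = [x, y]" by (auto simp: numeral_2_eq_2 length_Suc_conv)
  then show ?thesis using m by (auto simp: add_eq_conv_ex)
qed

text \<open>Two square-free words of the same length and with different patterns, such that the letter \<open>0\<close>
  occurs three times in the first word and twice in the second. They are chosen so that deleting some
  but not all letters, in either word, leaves a word that contains a square.\<close>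
abbreviation (input) left_word :: word where "left_word \<equiv> [0, 1, 0, 2, 0, 1, 2]"
abbreviation (input) right_word :: word where "right_word \<equiv> [0, 1, 2, 0, 2, 1, 2]"

lemma left_word_square_free: "square_free left_word"
  by (rule square_freeI_factors) code_simp

lemma right_word_square_free: "square_free right_word"
  by (rule square_freeI_factors) code_simp

text \<open>If the substitution deletes one of the three letters, then a square appears in the image; as \<open>w\<close> is
  square-free, the root of this square is deleted as well, and then in turn the third letter. If no
  letter is deleted, the image is at least as long as \<open>w\<close>, so letters go to letters and the context
  is empty.\<close>
lemma square_free_image_of_rigid_word:
  assumes w: "c @ subst \<psi> s @ d = w" and sf: "square_free w" and len: "length w = 7"
    and s: "s = left_word \<or> s = right_word"
  shows "(\<forall>x\<in>{0, 1, 2}. \<psi> x = []) \<or> c = [] \<and> d = [] \<and> (\<exists>f. \<forall>x\<in>{0, 1, 2}. \<psi> x = [f x])"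
proof (cases "\<psi> 0 = [] \<or> \<psi> 1 = [] \<or> \<psi> 2 = []")
  case True
  have sq: "p = []" if "w = c' @ p @ p @ d'" for c' p d' using sf that by (rule square_freeD)
  have "\<psi> 2 = []" if "\<psi> 0 = []"
    using s
  proof
    assume "s = left_word"
    with w that show ?thesis using sq[of c "\<psi> 1 @ \<psi> 2" d] by simp
  next
    assume "s = right_word"
    with w that show ?thesis using sq[of "c @ \<psi> 1" "\<psi> 2" "\<psi> 1 @ \<psi> 2 @ d"] by simp
  qed
  moreover have "\<psi> 0 = []" if "\<psi> 1 = []"
    using s
  proof
    assume "s = left_word"
    with w that show ?thesis using sq[of c "\<psi> 0" "\<psi> 2 @ \<psi> 0 @ \<psi> 2 @ d"] by simp
  next
    assume "s = right_word"
    with w that show ?thesis using sq[of c "\<psi> 0 @ \<psi> 2" "\<psi> 2 @ d"] by simp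
  qed
  moreover have "\<psi> 0 = []" if "\<psi> 2 = []"
    using s
  proof
    assume "s = left_word"
    with w that show ?thesis using sq[of "c @ \<psi> 0 @ \<psi> 1" "\<psi> 0" "\<psi> 1 @ d"] by simp
  next
    assume "s = right_word"
    with w that show ?thesis using sq[of c "\<psi> 0 @ \<psi> 1" d] by simp
  qed
  moreover have "\<psi> 1 = []" if "\<psi> 0 = []" "\<psi> 2 = []"
    using s
  proof
    assume "s = left_word"
    with w that show ?thesis using sq[of c "\<psi> 1" d] by simp
  next
    assume "s = right_word"
    with w that show ?thesis using sq[of c "\<psi> 1" d] by simp
  qed
  ultimately have "\<psi> 0 = [] \<and> \<psi> 1 = [] \<and> \<psi> 2 = []" using True by blast
  then show ?thesis by simp
next
  case False
  then have "length (\<psi> 0) \<ge> 1" "length (\<psi> 1) \<ge> 1" "length (\<psi> 2) \<ge> 1"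
    by (simp_all add: Suc_le_eq)
  moreover have "length c + length (subst \<psi> s) + length d = 7"
    using arg_cong[OF w, of length] len by simp
  moreover have "length (subst \<psi> s) = 3 * length (\<psi> 0) + 2 * length (\<psi> 1) + 2 * length (\<psi> 2) \<or>
      length (subst \<psi> s) = 2 * length (\<psi> 0) + 2 * length (\<psi> 1) + 3 * length (\<psi> 2)"
    using s by auto
  ultimately have 1: "length (\<psi> 0) = 1" "length (\<psi> 1) = 1" "length (\<psi> 2) = 1"
      and cd: "length c = 0" "length d = 0"
    by linarith+
  have "\<psi> x = [hd (\<psi> x)]" if "x \<in> {0, 1, 2}" for x
    using 1 that by (cases "\<psi> x") auto
  then have "\<exists>f. \<forall>x\<in>{0, 1, 2}. \<psi> x = [f x]" by (intro exI[of _ "\<lambda>x. hd (\<psi> x)"]) blast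
  with cd show ?thesis by simp
qed

lemma rigid_pair:
  assumes "(left_word, w) \<in> generated {(left_word, right_word)}"
  shows "w = left_word \<or> w = right_word"
proof -
  have "w \<in> {left_word, right_word}"
  proof (rule generated_closed[OF _ assms])
    fix c d \<psi> s t
    assume st: "(s, t) \<in> {(left_word, right_word)} \<or> (t, s) \<in> {(left_word, right_word)}"
      and w: "c @ subst \<psi> s @ d \<in> {left_word, right_word}"
    define v where "v = c @ subst \<psi> s @ d"
    have "square_free v" "length v = 7"
      using w left_word_square_free right_word_square_free unfolding v_def[symmetric] by auto
    then consider "\<forall>x\<in>{0, 1, 2}. \<psi> x = []"
      | f where "c = []" "d = []" "\<forall>x\<in>{0, 1, 2}. \<psi> x = [f x]"
      using square_free_image_of_rigid_word[OF v_def[symmetric]] st by blast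
    then show "c @ subst \<psi> t @ d \<in> {left_word, right_word}"
      using st w by cases auto
  qed simp
  then show ?thesis by simp
qed

section \<open>Semilattices\<close>

definition same_content :: "(word \<times> word) set" where
  "same_content = {(u, v). set u = set v}"

interpretation same_content: fully_invariant_congruence same_content
  by standard (auto simp: same_content_def set_subst)

text \<open>In a semilattice \<open>u\<close> absorbs every product of its own letters, so if \<open>u\<close> and \<open>v\<close> have the same
  letters, then \<open>u = v u = u v = v\<close>.\<close>
lemma (in fully_invariant_congruence) same_content_subset:
  assumes idem: "([0, 0], [0]) \<in> \<theta>" and comm: "([0, 1], [1, 0]) \<in> \<theta>"
  shows "same_content \<subseteq> \<theta>"
proof -
  have comm': "(u @ v, v @ u) \<in> \<theta>" for u v
    using subst[OF comm, of "\<lambda>x. if x = 0 then u else v"] by simp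
  have idem': "(u @ u, u) \<in> \<theta>" for u
    using subst[OF idem, of "\<lambda>x. u"] by simp
  have absorb_letter: "(x # u, u) \<in> \<theta>" if x: "x \<in> set u" for x u
  proof -
    obtain p q where u: "u = p @ x # q" using x by (meson split_list)
    have "([x] @ p @ [x] @ q, p @ [x] @ [x] @ q) \<in> \<theta>"
      using append[OF comm'[of "[x]" p] refl[of "[x] @ q"]] by simp
    moreover have "(p @ [x] @ [x] @ q, p @ [x] @ q) \<in> \<theta>"
      using append_context[OF idem'[of "[x]"], of p q] by simp
    ultimately show ?thesis using trans by (simp add: u)
  qed
  have absorb: "(v @ u, u) \<in> \<theta>" if "set v \<subseteq> set u" for u v
    using that
  proof (induction v)
    case (Cons x v)
    have "(x # v @ u, v @ u) \<in> \<theta>" using Cons.prems by (intro absorb_letter) auto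
    then show ?case using Cons trans by auto
  qed (simp add: refl)
  show ?thesis
  proof (clarsimp simp: same_content_def)
    fix u v :: word assume uv: "set u = set v"
    then show "(u, v) \<in> \<theta>"
      using absorb[of v u] absorb[of u v] comm'[of u v] sym trans by blast
  qed
qed

text \<open>The pair of words of length \<open>7\<close> gives \<open>x^2 = x^3\<close>, hence \<open>x^2 = x^n = x\<close>.\<close>
lemma modular_lower_modular_contains_same_content:
  fixes V :: "'a monoid_variety"
  assumes inf: "infinite (UNIV :: 'a set)" and m: "modular_element V" and lm: "lower_modular_element V"
    and uv: "(u, v) \<in> identities V" "u \<noteq> v"
  shows "same_content \<subseteq> identities V"
proof -
  interpret fully_invariant_congruence "identities V" by (rule identities_fully_invariant)
  obtain n where n: "n \<ge> 2" "([0], replicate n 0) \<in> identities V"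
    using lower_modular_imp_completely_regular[OF inf lm uv] by blast
  have "square_free [0, 1]" by (rule square_freeI_factors) code_simp
  then have comm: "([0, 1], [1, 0]) \<in> identities V"
    by (intro modular_completely_regular_satisfies[OF inf m n] commutativity_rigid) auto
  have "(left_word, right_word) \<in> identities V"
    by (intro modular_completely_regular_satisfies[OF inf m n] left_word_square_free rigid_pair) auto
  from sym[OF count_identity[OF this, of 0]]
  have step: "([0, 0], [0, 0, 0]) \<in> identities V" by (simp add: numeral_eq_Suc)
  have "([0, 0], replicate k 0) \<in> identities V" if "k \<ge> 2" for k
    using that
  proof (induction k rule: dec_induct)
    case base
    show ?case by (simp add: numeral_eq_Suc refl)
  next
    case (step k)
    obtain i where "k = 2 + i" using step.hyps le_Suc_ex by blast
    then have "(replicate k 0, replicate (Suc k) 0) \<in> identities V"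
      using append[OF \<open>([0, 0], [0, 0, 0]) \<in> identities V\<close> refl[of "replicate i 0"]] by (simp add: numeral_eq_Suc)
    with step.IH show ?case by (rule trans)
  qed
  then have "([0, 0], [0]) \<in> identities V" using n trans sym by blast
  then show ?thesis using comm by (rule same_content_subset)
qed

lemma semilattice_identities:
  assumes "infinite (UNIV :: 'a set)"
  shows "identities (semilattice_variety :: 'a monoid_variety) = same_content"
proof
  interpret fully_invariant_congruence "identities (semilattice_variety :: 'a monoid_variety)"
    by (rule identities_fully_invariant)
  have *: "satisfies M [0, 0] [0] \<and> satisfies M [0, 1] [1, 0]"
    if M: "comm_monoid M" "\<forall>x\<in>carrier M. x \<otimes>\<^bsub>M\<^esub> x = x" for M :: "'a monoid"
  proof -
    interpret comm_monoid M by fact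
    show ?thesis using M(2) by (auto simp: satisfies_def m_comm range_subsetD)
  qed
  have "([0, 0], [0]) \<in> identities (semilattice_variety :: 'a monoid_variety)"
    "([0, 1], [1, 0]) \<in> identities (semilattice_variety :: 'a monoid_variety)"
    using * by (auto simp: identities_def semilattice_variety.rep_eq)
  then show incl: "same_content \<subseteq> identities (semilattice_variety :: 'a monoid_variety)"
    by (rule same_content_subset)
  show "identities (semilattice_variety :: 'a monoid_variety) \<subseteq> same_content"
  proof (clarsimp simp: same_content_def, rule ccontr)
    fix u v assume "(u, v) \<in> identities (semilattice_variety :: 'a monoid_variety)" "set u \<noteq> set v"
    then obtain n where "n \<ge> 1" "([], replicate n 0) \<in> identities (semilattice_variety :: 'a monoid_variety)"
      by (rule content_change_imp_periodic)
    moreover from \<open>n \<ge> 1\<close> have "([0], replicate n 0) \<in> same_content" by (auto simp: same_content_def)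
    ultimately have trivial: "([0], []) \<in> identities (semilattice_variety :: 'a monoid_variety)"
      using incl sym trans by blast
    \<comment> \<open>The two-element semilattice, with unit \<open>a\<close> and zero \<open>b\<close>, on two elements of the universe.\<close>
    obtain a b :: 'a where "a \<noteq> b" using assms by (metis (full_types) UNIV_eq_I finite.simps singletonI)
    define M :: "'a monoid" where
      "M = \<lparr>carrier = {a, b}, monoid.mult = \<lambda>x y. if x = a then y else b, one = a\<rparr>"
    have M: "carrier M = {a, b}" "\<And>x y. x \<otimes>\<^bsub>M\<^esub> y = (if x = a then y else b)" "\<one>\<^bsub>M\<^esub> = a"
      by (simp_all add: M_def)
    have "comm_monoid M" by (rule comm_monoidI) (auto simp: M)
    then have "M \<in> members semilattice_variety" by (auto simp: semilattice_variety.rep_eq M)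
    with trivial have "satisfies M [0] []" by (auto simp: identities_def)
    moreover have "range (\<lambda>_. b) \<subseteq> carrier M" by (auto simp: M)
    ultimately have "eval_word M (\<lambda>_. b) [0] = eval_word M (\<lambda>_. b) []"
      unfolding satisfies_def by blast
    with \<open>a \<noteq> b\<close> show False by (simp add: M)
  qed
qed

lemma trivial_variety_identities: "identities (trivial_variety :: 'a monoid_variety) = UNIV"
proof -
  have "satisfies M u v" if M: "monoid M" "carrier M = {\<one>\<^bsub>M\<^esub>}" for M :: "'a monoid" and u v
    unfolding satisfies_def
  proof (intro allI impI)
    fix \<phi> :: "nat \<Rightarrow> 'a" assume "range \<phi> \<subseteq> carrier M"
    from eval_word_closed[OF M(1) this] show "eval_word M \<phi> u = eval_word M \<phi> v" by (simp add: M(2))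
  qed
  then show ?thesis by (auto simp: identities_def trivial_variety.rep_eq)
qed

lemma trivial_identity_imp_trivial:
  assumes "([0], []) \<in> identities V"
  shows "V = trivial_variety"
proof (rule antisym)
  show "trivial_variety \<le> V" by (simp add: le_iff_identities trivial_variety_identities)
  interpret fully_invariant_congruence "identities V" by (rule identities_fully_invariant)
  have Nil: "(w, []) \<in> identities V" for w
    using raise_equivalent[of 0 w] assms by (simp add: subst_eq_Nil[THEN iffD2])
  have "(u, v) \<in> identities V" for u v by (rule trans[OF Nil sym[OF Nil]])
  then show "V \<le> trivial_variety" by (simp add: le_iff_identities subrelI)
qed

lemma all_monoids_greatest: "V \<le> all_monoids_variety"
  by (auto simp: less_eq_monoid_variety.rep_eq all_monoids_variety.rep_eq members_monoid)

text \<open>Below the semilattices there is only the trivial variety: an identity that fails in a semilattice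
  changes the letters, so it yields \<open>x^n = 1\<close>, which idempotency turns into \<open>x = 1\<close>.\<close>
lemma contains_same_content_cases:
  fixes V :: "'a monoid_variety"
  assumes inf: "infinite (UNIV :: 'a set)" and incl: "same_content \<subseteq> identities V"
  shows "V = trivial_variety \<or> V = semilattice_variety"
proof (cases "identities V \<subseteq> same_content")
  case True
  with incl have "identities V = identities (semilattice_variety :: 'a monoid_variety)"
    by (simp add: semilattice_identities[OF inf])
  then show ?thesis by (simp add: antisym le_iff_identities)
next
  case False
  interpret fully_invariant_congruence "identities V" by (rule identities_fully_invariant)
  from False obtain u v where "(u, v) \<in> identities V" "set u \<noteq> set v"
    by (auto simp: same_content_def)
  then obtain n where "n \<ge> 1" "([], replicate n 0) \<in> identities V"
    by (rule content_change_imp_periodic)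
  moreover from \<open>n \<ge> 1\<close> have "([0], replicate n 0) \<in> same_content" by (auto simp: same_content_def)
  ultimately have "([0], []) \<in> identities V" using incl sym trans by blast
  then show ?thesis by (simp add: trivial_identity_imp_trivial)
qed

text \<open>The map that deletes the letters foreign to \<open>u\<close> and then appends \<open>e = raise n u\<close> turns every step
  of a chain from \<open>u\<close> to \<open>v\<close> into a step between words with the same letters as \<open>u\<close>. Appending \<open>e\<close>
  to \<open>u\<close> and to \<open>v\<close> is itself an identity of \<open>Y\<close> that preserves the letters.\<close>
lemma median_same_content_equal_content:
  assumes Y: "fully_invariant_congruence Y" and Z: "fully_invariant_congruence Z"
    and uv: "(u, v) \<in> (Y \<union> Z)\<^sup>*" "set u = set v"
    and n: "n \<ge> 1" "([], replicate n 0) \<in> Y"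
    and T: "fully_invariant_congruence T" "same_content \<inter> Y \<subseteq> T" "same_content \<inter> Z \<subseteq> T"
  shows "(u, v) \<in> T"
proof -
  interpret Y: fully_invariant_congruence Y by fact
  interpret Z: fully_invariant_congruence Z by fact
  interpret T: fully_invariant_congruence T by fact
  define e where "e = raise n u"
  define \<rho> where "\<rho> x = (if x \<in> set u then [x] else [])" for x
  have \<rho>: "subst \<rho> w = w" if "set w \<subseteq> set u" for w
    using that by (induction w) (auto simp: \<rho>_def)
  have set_e: "set e = set u" by (simp add: e_def set_raise[OF n(1)])
  have eT: "(w, w @ e) \<in> T" if "set w = set u" for w
  proof -
    have "(w, w @ e) \<in> Y"
      using Y.append[OF Y.refl[of w] Y.raise_equivalent_Nil[OF n(2), of u]] by (simp add: e_def)
    moreover have "(w, w @ e) \<in> same_content" using that set_e by (simp add: same_content_def)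
    ultimately show ?thesis using T(2) by blast
  qed
  have "(u, subst \<rho> v @ e) \<in> T"
    using uv(1)
  proof (induction rule: rtrancl_induct)
    case base
    show ?case using eT[of u] by (simp add: \<rho>)
  next
    case (step w w')
    have "set (subst \<rho> x @ e) = set u" for x
      using set_e by (auto simp: set_subst \<rho>_def split: if_splits)
    then have "(subst \<rho> w @ e, subst \<rho> w' @ e) \<in> same_content" by (simp add: same_content_def)
    moreover have "(subst \<rho> w @ e, subst \<rho> w' @ e) \<in> Y \<union> Z"
      using step.hyps(2) Y.append[OF Y.subst Y.refl] Z.append[OF Z.subst Z.refl] by blast
    ultimately have "(subst \<rho> w @ e, subst \<rho> w' @ e) \<in> T" using T(2,3) by blast
    with step.IH show ?case by (rule T.trans)
  qed
  then have "(u, v @ e) \<in> T" using uv(2) by (simp add: \<rho>)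
  then show ?thesis using eT[of v] uv(2) T.trans T.sym by metis
qed

text \<open>The nontrivial half of the median identity, with congruences in place of varieties. If \<open>u\<close> and \<open>v\<close>
  have different letters, then neither \<open>Y\<close> nor \<open>Z\<close> preserves letters, so \<open>Y\<close> and \<open>Z\<close> share an
  identity \<open>x^n = 1\<close>. It allows one to append powers of all letters of \<open>u\<close> and \<open>v\<close> to both words, which
  reduces the claim to words with the same letters.\<close>
lemma median_same_content:
  assumes Y: "fully_invariant_congruence Y" and Z: "fully_invariant_congruence Z"
    and T: "fully_invariant_congruence T" "same_content \<inter> Y \<subseteq> T" "Y \<inter> Z \<subseteq> T" "same_content \<inter> Z \<subseteq> T"
    and uv: "(u, v) \<in> (same_content \<union> Y)\<^sup>*" "(u, v) \<in> (Y \<union> Z)\<^sup>*" "(u, v) \<in> (same_content \<union> Z)\<^sup>*"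
  shows "(u, v) \<in> T"
proof -
  interpret Y: fully_invariant_congruence Y by fact
  interpret Z: fully_invariant_congruence Z by fact
  interpret T: fully_invariant_congruence T by fact
  have YZ: "fully_invariant_congruence ((Y \<union> Z)\<^sup>*)" using Y Z by (rule fully_invariant_join)
  have periodic: "\<exists>n\<ge>1. ([], replicate n 0) \<in> X"
    if "fully_invariant_congruence X" "\<not> X \<subseteq> same_content" for X
  proof -
    interpret X: fully_invariant_congruence X by fact
    from that(2) obtain p q where "(p, q) \<in> X" "set p \<noteq> set q" by (auto simp: same_content_def)
    then show ?thesis by (metis X.content_change_imp_periodic)
  qed
  have equal_content: "(p, q) \<in> T" if pq: "(p, q) \<in> (Y \<union> Z)\<^sup>*" "set p = set q" for p q
  proof -
    consider "Y \<subseteq> same_content" "Z \<subseteq> same_content" | "\<not> Y \<subseteq> same_content" | "\<not> Z \<subseteq> same_content"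
      by blast
    then show ?thesis
    proof cases
      case 1
      then have "(Y \<union> Z)\<^sup>* \<subseteq> T" using T(2,4) by (intro T.rtrancl_subset_congruence) blast
      with pq(1) show ?thesis by blast
    next
      case 2
      then obtain n where "n \<ge> 1" "([], replicate n 0) \<in> Y" using periodic[OF Y] by blast
      then show ?thesis by (rule median_same_content_equal_content[OF Y Z pq _ _ T(1,2,4)])
    next
      case 3
      then obtain n where "n \<ge> 1" "([], replicate n 0) \<in> Z" using periodic[OF Z] by blast
      then show ?thesis
        using pq by (intro median_same_content_equal_content[OF Z Y _ _ _ _ T(1,4,2)]) (auto simp: Un_commute)
    qed
  qed
  show ?thesis
  proof (cases "set u = set v")
    case True
    with uv(2) show ?thesis by (rule equal_content)
  next
    case False
    then have uv_not: "(u, v) \<notin> same_content" by (simp add: same_content_def)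
    have "\<not> Y \<subseteq> same_content" "\<not> Z \<subseteq> same_content"
      using uv(1,3) uv_not same_content.rtrancl_subset_congruence[of "same_content \<union> Y"]
        same_content.rtrancl_subset_congruence[of "same_content \<union> Z"] by blast+
    then obtain k l where k: "k \<ge> 1" "([], replicate k 0) \<in> Y" and l: "l \<ge> 1" "([], replicate l 0) \<in> Z"
      using periodic[OF Y] periodic[OF Z] by blast
    define e where "e = raise (k * l) (u @ v)"
    have "([], replicate (k * l) 0) \<in> Y \<inter> Z"
      using Y.Nil_power[OF k(2), of l] Z.Nil_power[OF l(2), of k] by (simp add: mult.commute)
    then have "([], e) \<in> Y \<inter> Z"
      unfolding e_def using Y.raise_equivalent_Nil Z.raise_equivalent_Nil by blast
    then have e: "(w, w @ e) \<in> T" for w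
      using Y.append[OF Y.refl[of w], of "[]" e] Z.append[OF Z.refl[of w], of "[]" e] T(3) by auto
    have "set e = set u \<union> set v" using k(1) l(1) by (simp add: e_def set_raise)
    then have "set (u @ e) = set (v @ e)" by auto
    moreover have "(u @ e, v @ e) \<in> (Y \<union> Z)\<^sup>*"
      using fully_invariant_congruence.append_context[OF YZ uv(2), of "[]" e] by simp
    ultimately have "(u @ e, v @ e) \<in> T" by (rule equal_content[rotated])
    then show ?thesis using e[of u] e[of v] T.trans T.sym by blast
  qed
qed

lemma semilattice_neutral:
  assumes inf: "infinite (UNIV :: 'a set)"
  shows "neutral_element (semilattice_variety :: 'a monoid_variety)"
  unfolding neutral_element_def
proof (intro allI antisym)
  fix Y Z :: "'a monoid_variety"
  let ?X = "semilattice_variety :: 'a monoid_variety"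
  let ?L = "inf (inf (sup ?X Y) (sup Y Z)) (sup Z ?X)"
  let ?R = "sup (sup (inf ?X Y) (inf Y Z)) (inf Z ?X)"
  show "?R \<le> ?L" by (meson inf_le1 inf_le2 le_inf_iff le_supI le_supI1 le_supI2 order_refl)
  note id = identities_sup[OF inf] identities_inf[OF inf] semilattice_identities[OF inf]
  have "?L \<le> sup ?X Y" "?L \<le> sup Y Z" "?L \<le> sup Z ?X" by (auto intro: le_infI1)
  then have T: "same_content \<inter> identities Y \<subseteq> identities ?L" "identities Y \<inter> identities Z \<subseteq> identities ?L"
      "same_content \<inter> identities Z \<subseteq> identities ?L"
    by (simp_all only: le_iff_identities id Int_commute)
  show "?L \<le> ?R"
    unfolding le_iff_identities
  proof clarify
    fix u v assume "(u, v) \<in> identities ?R"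
    then have "(u, v) \<in> (same_content \<union> identities Y)\<^sup>*" "(u, v) \<in> (identities Y \<union> identities Z)\<^sup>*"
      "(u, v) \<in> (same_content \<union> identities Z)\<^sup>*"
      by (simp_all add: id Un_commute)
    then show "(u, v) \<in> identities ?L"
      by (rule median_same_content[OF identities_fully_invariant identities_fully_invariant
            identities_fully_invariant T])
  qed
qed

theorem theorem1:
  fixes V :: "'a monoid_variety"
  assumes "infinite (UNIV :: 'a set)"
  shows "(modular_element V \<and> lower_modular_element V \<longleftrightarrow> standard_element V)
       \<and> (standard_element V \<longleftrightarrow> neutral_element V)
       \<and> (neutral_element V \<longleftrightarrow>
            V = trivial_variety \<or> V = semilattice_variety \<or> V = all_monoids_variety)"
proof -
  have "neutral_element V"
    if "V = trivial_variety \<or> V = semilattice_variety \<or> V = all_monoids_variety"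
  proof -
    have "neutral_element (trivial_variety :: 'a monoid_variety)"
      by (rule bottom_neutral) (simp add: le_iff_identities trivial_variety_identities)
    moreover have "neutral_element (all_monoids_variety :: 'a monoid_variety)"
      by (rule top_neutral) (rule all_monoids_greatest)
    ultimately show ?thesis using that semilattice_neutral[OF assms] by blast
  qed
  moreover have "V = trivial_variety \<or> V = semilattice_variety \<or> V = all_monoids_variety"
    if "modular_element V" "lower_modular_element V"
  proof (cases "\<forall>(u, v) \<in> identities V. u = v")
    case True
    interpret fully_invariant_congruence "identities (all_monoids_variety :: 'a monoid_variety)"
      by (rule identities_fully_invariant)
    have "all_monoids_variety \<le> V" using True by (auto simp: le_iff_identities refl)
    then show ?thesis using all_monoids_greatest antisym by blast
  next
    case False
    then obtain u v where "(u, v) \<in> identities V" "u \<noteq> v" by blast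
    from modular_lower_modular_contains_same_content[OF assms that this]
    show ?thesis using contains_same_content_cases[OF assms] by blast
  qed
  ultimately show ?thesis
    using neutral_imp_standard standard_imp_modular standard_imp_lower_modular by blast
qed

end
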